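(* Let $0<q<1$ and $\nu>-1$ be fixed, and let $\{\theta_m\}_{m\ge 1}$ be a sequence of real numbers such that $0\leq\theta_m<1$ for $m=1,2,3,\ldots$. Then: (i) if $\lim_{m\to\infty}m\theta_m=0$, then, for all sufficiently large $m$, $\operatorname{sgn}\left(\left.\frac{\partial J_{\nu}(z;q^2)}{\partial z}\right|_{z=q^{-m+\theta_m}}\right)=(-1)^{m}$; (ii) if $\lim_{m\to\infty}m\theta_m=\infty$, then, for all sufficiently large $m$, $\operatorname{sgn}\left(\left.\frac{\partial J_{\nu}(z;q^2)}{\partial z}\right|_{z=q^{-m+\theta_m}}\right)=(-1)^{m-1}$.
   Context: For $0<p<1$: $(a;p)_0=1$, $(a;p)_n=\prod_{i=0}^{n-1}(1-ap^i)$, $(a;p)_\infty=\lim_{n\to\infty}(a;p)_n$. The third Jackson (Hahn--Exton) $q$-Bessel function, with base $q^2$, is defined for $z>0$ by $$J_{\nu}(z;q^2)=z^{\nu}\frac{(q^{2(\nu+1)};q^2)_\infty}{(q^2;q^2)_\infty}\sum_{k=0}^{\infty}(-1)^k\frac{q^{k(k+1)}}{(q^{2(\nu+1)};q^2)_k\,(q^2;q^2)_k}z^{2k}.$$ $\operatorname{sgn}(x)\in\{-1,0,1\}$ is the sign of the real number $x$. *)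

theory Defs
  imports "HOL-Analysis.Analysis"
begin

definition qpoch :: "real \<Rightarrow> real \<Rightarrow> nat \<Rightarrow> real" where
  "qpoch a p n = (\<Prod>i<n. 1 - a * p ^ i)"

definition qpoch_inf :: "real \<Rightarrow> real \<Rightarrow> real" where
  "qpoch_inf a p = lim (\<lambda>n. qpoch a p n)"

text \<open>The third Jackson (Hahn--Exton) q-Bessel function \<open>J\<^sub>\<nu>(z; q\<^sup>2)\<close>, for \<open>z > 0\<close>. The second
  argument is \<open>q\<close>, not the base \<open>q\<^sup>2\<close>. The order \<open>\<nu>\<close> is real, hence \<open>powr\<close> for \<open>z\<^sup>\<nu>\<close> and
  \<open>q\<close> to the power \<open>2(\<nu>+1)\<close>.\<close>

definition hahn_exton_J :: "real \<Rightarrow> real \<Rightarrow> real \<Rightarrow> real" where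
  "hahn_exton_J \<nu> q z =
     z powr \<nu> * (qpoch_inf (q powr (2 * (\<nu> + 1))) (q\<^sup>2) / qpoch_inf (q\<^sup>2) (q\<^sup>2)) *
     (\<Sum>k. (-1) ^ k * (q ^ (k * (k + 1)) /
            (qpoch (q powr (2 * (\<nu> + 1))) (q\<^sup>2) k * qpoch (q\<^sup>2) (q\<^sup>2) k)) * z ^ (2 * k))"

end

theory Submission
  imports Defs
begin

text \<open>Put \<open>p = q\<^sup>2\<close>. Up to the positive factor \<open>z\<^bsup>\<nu>-1\<^esup>\<close> and a positive constant, the derivative is the power series
  \<open>\<Sum>k. (-1)\<^sup>k q\<^bsup>k(k+1)\<^esup> (2k + \<nu>) w\<^sub>k z\<^bsup>2k\<^esup>\<close> with \<open>w\<^sub>k = 1 / ((p\<^bsup>\<nu>+1\<^esup>;p)\<^sub>k (p;p)\<^sub>k)\<close>. At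
  \<open>z = q\<^bsup>-m+\<theta>\<^esup>\<close> the moduli of its terms form a discrete Gaussian centred near \<open>k = m\<close>, so it is natural to
  substitute \<open>k = m + n\<close> with \<open>n\<close> an integer. Everything that does not depend on \<open>n\<close> factors out as
  \<open>(-1)\<^sup>m\<close> times a positive number, and with \<open>y = q\<^bsup>2\<theta>\<^esup> \<in> (p, 1]\<close> there remains
  \<open>U\<^sub>m = \<Sum>n. (-1)\<^sup>n q\<^bsup>n(n+1)\<^esup> (2(m+n) + \<nu>) w\<^bsub>m+n\<^esub> y\<^sup>n\<close>, where \<open>w\<close> vanishes at negative indices.
  The sign of the derivative is therefore \<open>(-1)\<^sup>m\<close> times the sign of \<open>U\<^sub>m\<close>.

  The weights converge geometrically to a limit \<open>W > 0\<close>, so replacing \<open>w\<^bsub>m+n\<^esub>\<close> by \<open>W\<close> changes \<open>U\<^sub>m\<close> only by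
  \<open>o(1)\<close>, uniformly in \<open>y\<close>, in spite of the factor \<open>2(m+n) + \<nu>\<close> (\<open>theta_series_perturbation\<close>). What is left is
  \<open>W ((2m + \<nu>) T(y) + 2 D(y))\<close> with the Jacobi theta function \<open>T(y) = \<Sum>n. (-1)\<^sup>n q\<^bsup>n(n+1)\<^esup> y\<^sup>n\<close>
  and its Euler derivative \<open>D(y) = y T'(y)\<close>.

  The triple product \<open>T(y) = (1 - 1/y) (p;p)\<^sub>\<infinity> (p/y;p)\<^sub>\<infinity> (yp;p)\<^sub>\<infinity>\<close> (\<open>jacobi_triple_product\<close>) shows that \<open>T\<close> has simple
  zeros at \<open>y = 1\<close> and \<open>y = p\<close> and is negative in between; quantitatively \<open>T\<close> lies between
  \<open>- (1-y)/p\<close> and \<open>- c (1-y) (y-p)\<close> for some \<open>c > 0\<close> (\<open>jacobi_theta_bounds\<close>). Comparing difference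
  quotients gives \<open>D(1) > 0\<close> and \<open>D(p) < 0\<close> (\<open>theta_derivative_signs_endpoints\<close>). Finally \<open>1 - y\<close> is comparable to \<open>\<theta>\<close>.

  If \<open>m \<theta>\<^sub>m \<longrightarrow> 0\<close>, then \<open>y \<longrightarrow> 1\<close> and \<open>m T(y) = O(m \<theta>\<^sub>m)\<close> disappears, leaving the limit
  \<open>2 W D(1) > 0\<close>. If \<open>m \<theta>\<^sub>m \<longrightarrow> \<infinity>\<close>, then away from \<open>y = p\<close> the term \<open>(2m + \<nu>) T(y)\<close> tends to \<open>-\<infinity>\<close>
  and dominates the bounded \<open>D\<close>, while near \<open>y = p\<close> both terms are nonpositive and \<open>D\<close> is bounded
  away from \<open>0\<close>. This second region has to be treated separately because \<open>\<theta>\<^sub>m\<close> may approach \<open>1\<close>.\<close>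

section \<open>q-Pochhammer symbols and their infinite limits\<close>

lemma qpoch_0 [simp]: "qpoch a p 0 = 1"
  by (simp add: qpoch_def)

lemma qpoch_Suc: "qpoch a p (Suc n) = qpoch a p n * (1 - a * p ^ n)"
  by (simp add: qpoch_def)

lemma qpoch_Suc_shift: "qpoch a p (Suc n) = (1 - a) * qpoch (a * p) p n"
  unfolding qpoch_def by (subst prod.lessThan_Suc_shift) (simp add: mult.assoc)

lemma qpoch_factor_bounds:
  fixes a p :: real
  assumes "0 \<le> a" "a \<le> 1" "0 < p" "p < 1"
  shows "0 \<le> 1 - a * p ^ i" "1 - a * p ^ i \<le> 1"
proof -
  have "a * p ^ i \<le> 1 * 1"
    using assms by (intro mult_mono power_le_one) auto
  then show "0 \<le> 1 - a * p ^ i" by simp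
qed (use assms in simp)

lemma qpoch_bounds:
  assumes "0 \<le> a" "a \<le> 1" "0 < p" "p < 1"
  shows "0 \<le> qpoch a p n" "qpoch a p n \<le> 1"
  using qpoch_factor_bounds[OF assms] unfolding qpoch_def
  by (auto intro: prod_nonneg prod_le_1)

lemma qpoch_pos:
  assumes "0 \<le> a" "a < 1" "0 < p" "p < 1"
  shows "0 < qpoch a p n"
proof -
  have "a * p ^ i < 1" for i
  proof -
    have "a * p ^ i \<le> a * 1"
      using assms by (intro mult_left_mono power_le_one) auto
    then show ?thesis using assms by simp
  qed
  then show ?thesis unfolding qpoch_def by (auto intro: prod_pos)
qed

lemma qpoch_decseq:
  assumes "0 \<le> a" "a \<le> 1" "0 < p" "p < 1"
  shows "decseq (qpoch a p)"
proof (rule decseq_SucI)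
  fix n
  show "qpoch a p (Suc n) \<le> qpoch a p n"
    unfolding qpoch_Suc
    using mult_left_mono[OF qpoch_factor_bounds(2)[OF assms] qpoch_bounds(1)[OF assms], of n n] by simp
qed

lemma qpoch_antimono:
  assumes "0 \<le> a" "a \<le> b" "b \<le> 1" "0 < p" "p < 1"
  shows "qpoch b p n \<le> qpoch a p n"
  unfolding qpoch_def
proof (rule prod_mono)
  fix i
  have "a * p ^ i \<le> b * p ^ i" using assms by (intro mult_right_mono) auto
  then show "0 \<le> 1 - b * p ^ i \<and> 1 - b * p ^ i \<le> 1 - a * p ^ i"
    using qpoch_factor_bounds[of b p i] assms by auto
qed

lemma convergent_prod_qpoch:
  fixes a p :: real
  assumes "0 < p" "p < 1"
  shows "convergent_prod (\<lambda>i. 1 - a * p ^ i)"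
proof -
  have "summable (\<lambda>i. \<bar>a\<bar> * p ^ i)"
    using assms by (intro summable_mult summable_geometric) auto
  then have "summable (\<lambda>i. norm ((1 - a * p ^ i) - 1))"
    using assms by (simp add: abs_mult)
  then show ?thesis
    by (intro abs_convergent_prod_imp_convergent_prod summable_imp_abs_convergent_prod)
qed

lemma qpoch_LIMSEQ_prodinf:
  assumes "0 < p" "p < 1"
  shows "qpoch a p \<longlonglongrightarrow> prodinf (\<lambda>i. 1 - a * p ^ i)"
proof -
  have "(\<lambda>n. qpoch a p (Suc n)) \<longlonglongrightarrow> prodinf (\<lambda>i. 1 - a * p ^ i)"
    using convergent_prod_LIMSEQ[OF convergent_prod_qpoch[OF assms]]
    by (simp add: qpoch_def lessThan_Suc_atMost)
  then show ?thesis by (simp add: filterlim_sequentially_Suc)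
qed

lemma qpoch_inf_eq_prodinf:
  assumes "0 < p" "p < 1"
  shows "qpoch_inf a p = prodinf (\<lambda>i. 1 - a * p ^ i)"
  unfolding qpoch_inf_def using qpoch_LIMSEQ_prodinf[OF assms] by (rule limI)

lemma qpoch_LIMSEQ:
  assumes "0 < p" "p < 1"
  shows "qpoch a p \<longlonglongrightarrow> qpoch_inf a p"
  using qpoch_LIMSEQ_prodinf[OF assms] qpoch_inf_eq_prodinf[OF assms] by simp

lemma qpoch_inf_le:
  assumes "0 \<le> a" "a \<le> 1" "0 < p" "p < 1"
  shows "qpoch_inf a p \<le> qpoch a p n"
  using decseq_ge[OF qpoch_decseq[OF assms] qpoch_LIMSEQ] assms by auto

lemma qpoch_inf_nonneg:
  assumes "0 \<le> a" "a \<le> 1" "0 < p" "p < 1"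
  shows "0 \<le> qpoch_inf a p"
  using LIMSEQ_le_const[OF qpoch_LIMSEQ] qpoch_bounds(1) assms by blast

lemma qpoch_inf_pos:
  assumes "0 \<le> a" "a < 1" "0 < p" "p < 1"
  shows "0 < qpoch_inf a p"
proof -
  have "1 - a * p ^ i \<noteq> 0" for i
    using qpoch_pos[OF assms, of "Suc i"] by (auto simp: qpoch_Suc)
  then have "qpoch_inf a p \<noteq> 0"
    using prodinf_nonzero[OF convergent_prod_qpoch[of p a]] qpoch_inf_eq_prodinf[of p a] assms by auto
  then show ?thesis using qpoch_inf_nonneg[of a p] assms by simp
qed

lemma qpoch_inf_antimono:
  assumes "0 \<le> a" "a \<le> b" "b \<le> 1" "0 < p" "p < 1"
  shows "qpoch_inf b p \<le> qpoch_inf a p"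
  using assms by (intro LIMSEQ_le[OF qpoch_LIMSEQ qpoch_LIMSEQ]) (auto intro: qpoch_antimono)

lemma qpoch_inf_shift:
  assumes "0 < p" "p < 1"
  shows "qpoch_inf a p = (1 - a) * qpoch_inf (a * p) p"
proof -
  have "(\<lambda>n. qpoch a p (Suc n)) \<longlonglongrightarrow> (1 - a) * qpoch_inf (a * p) p"
    unfolding qpoch_Suc_shift by (intro tendsto_intros qpoch_LIMSEQ assms)
  then have "qpoch a p \<longlonglongrightarrow> (1 - a) * qpoch_inf (a * p) p"
    by (simp add: filterlim_sequentially_Suc)
  then show ?thesis using qpoch_LIMSEQ[OF assms] LIMSEQ_unique by blast
qed

text \<open>One step lowers the product by at most \<open>p ^ N\<close>, which is exactly what the geometric tail
  \<open>p ^ N / (1 - p)\<close> loses, so their difference increases with \<open>N\<close>.\<close>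
lemma qpoch_tail_bound:
  assumes "0 \<le> a" "a \<le> 1" "0 < p" "p < 1"
  shows "qpoch a p n - qpoch_inf a p \<le> p ^ n / (1 - p)"
proof -
  have "qpoch a p n - p ^ n / (1 - p) \<le> qpoch a p N - p ^ N / (1 - p)" if "n \<le> N" for N
    using that
  proof (induction N rule: dec_induct)
    case (step N)
    have "qpoch a p N * (a * p ^ N) \<le> 1 * (1 * p ^ N)"
      using assms qpoch_bounds[OF assms] by (intro mult_mono) auto
    moreover have "p ^ N / (1 - p) - p ^ Suc N / (1 - p) = p ^ N"
    proof -
      have "p ^ N - p ^ Suc N = p ^ N * (1 - p)" by (simp add: algebra_simps)
      then show ?thesis using assms by (simp flip: diff_divide_distrib)
    qed
    ultimately show ?case using step.IH by (simp add: qpoch_Suc algebra_simps)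
  qed simp
  moreover have "(\<lambda>N. qpoch a p N - p ^ N / (1 - p)) \<longlonglongrightarrow> qpoch_inf a p - 0 / (1 - p)"
    using assms by (intro tendsto_intros qpoch_LIMSEQ LIMSEQ_power_zero) auto
  ultimately have "qpoch a p n - p ^ n / (1 - p) \<le> qpoch_inf a p - 0 / (1 - p)"
    by (intro LIMSEQ_le_const) auto
  then show ?thesis by simp
qed

lemma qpoch_rate:
  assumes "0 \<le> a" "a \<le> 1" "0 < p" "p < 1"
  shows "(\<lambda>n. real n * (qpoch a p n - qpoch_inf a p)) \<longlonglongrightarrow> 0"
proof (rule tendsto_sandwich)
  show "\<forall>\<^sub>F n in sequentially. 0 \<le> real n * (qpoch a p n - qpoch_inf a p)"
    using qpoch_inf_le[OF assms] by simp
  show "\<forall>\<^sub>F n in sequentially. real n * (qpoch a p n - qpoch_inf a p) \<le> real n * p ^ n * (1 / (1 - p))"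
    using mult_left_mono[OF qpoch_tail_bound[OF assms] of_nat_0_le_iff]
    by (simp add: field_simps)
  have "(\<lambda>n. real n * p ^ n * (1 / (1 - p))) \<longlonglongrightarrow> 0 * (1 / (1 - p))"
    using assms by (intro tendsto_intros powser_times_n_limit_0) auto
  then show "(\<lambda>n. real n * p ^ n * (1 / (1 - p))) \<longlonglongrightarrow> 0" by simp
qed simp_all

section \<open>The finite q-binomial theorem\<close>

text \<open>The Gaussian binomial coefficient, extended by \<open>0\<close> beyond \<open>k = n\<close> so that it can serve as a
  coefficient of an infinite series.\<close>
definition qbinom :: "real \<Rightarrow> nat \<Rightarrow> nat \<Rightarrow> real" where
  "qbinom p n k = (if k \<le> n then qpoch p p n / (qpoch p p k * qpoch p p (n - k)) else 0)"

lemma qbinom_0 [simp]: "0 < p \<Longrightarrow> p < 1 \<Longrightarrow> qbinom p n 0 = 1"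
  using qpoch_pos[of p p n] by (simp add: qbinom_def)

lemma qbinom_pascal:
  assumes p: "0 < p" "p < 1" and "k \<le> n"
  shows "qbinom p (Suc n) (Suc k) = qbinom p n (Suc k) + p ^ (n - k) * qbinom p n k"
proof -
  have pos: "qpoch p p i > 0" for i using qpoch_pos[of p p i] p by simp
  have nz: "1 - p ^ Suc i \<noteq> 0" for i using power_Suc_less_one[of p i] p by simp
  show ?thesis
  proof (cases "k = n")
    case True
    then show ?thesis using pos[of n] pos[of "Suc n"] by (simp add: qbinom_def)
  next
    case False
    then obtain d where d: "n = k + Suc d" using \<open>k \<le> n\<close> less_iff_Suc_add by (metis add_Suc_right le_neq_implies_less)
    have nk: "n - k = Suc d" "n - Suc k = d" "Suc n - Suc k = Suc d" using d by auto
    have cond: "Suc k \<le> Suc n" "Suc k \<le> n" using d by auto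
    have S: "qpoch p p (Suc i) = qpoch p p i * (1 - p ^ Suc i)" for i by (simp add: qpoch_Suc)
    have e: "p ^ Suc n = p ^ Suc d * p ^ Suc k" by (simp add: d power_add)
    have "qbinom p (Suc n) (Suc k) = qpoch p p n * (1 - p ^ Suc n)
            / (qpoch p p k * (1 - p ^ Suc k) * (qpoch p p d * (1 - p ^ Suc d)))"
      by (simp only: qbinom_def S[of n] S[of k] S[of d] nk cond if_True)
    also have "\<dots> = qpoch p p n / (qpoch p p k * (1 - p ^ Suc k) * qpoch p p d)
          + p ^ Suc d * (qpoch p p n / (qpoch p p k * (qpoch p p d * (1 - p ^ Suc d))))"
      using pos[of k] pos[of d] nz[of k] nz[of d] unfolding e
      by (simp add: divide_simps del: power_Suc) (simp add: algebra_simps del: power_Suc)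
    also have "\<dots> = qbinom p n (Suc k) + p ^ (n - k) * qbinom p n k"
      by (simp only: qbinom_def S[of k] S[of d] nk cond \<open>k \<le> n\<close> if_True)
    finally show ?thesis .
  qed
qed

text \<open>Rothe's q-binomial theorem, in a normalisation where the Gaussian weight \<open>q ^ (k * (k + 1))\<close> is the
  one of the Hahn--Exton series: both are then instances of the same recentring. Multiplication by
  the new factor \<open>1 - x p ^ (n + 1)\<close>, where \<open>p = q\<^sup>2\<close>, acts on coefficients as the q-Pascal rule.\<close>
lemma rothe_identity:
  assumes q: "0 < q" "q < 1"
  shows "qpoch (x * q\<^sup>2) (q\<^sup>2) n = (\<Sum>k\<le>n. (-1) ^ k * q ^ (k * (k + 1)) * qbinom (q\<^sup>2) n k * x ^ k)"
proof (induction n)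
  case 0
  then show ?case by (simp add: qbinom_def)
next
  case (Suc n)
  have p: "0 < q\<^sup>2" "q\<^sup>2 < 1" using q by (auto simp: power_less_one_iff)
  define g where "g n k = (-1) ^ k * q ^ (k * (k + 1)) * qbinom (q\<^sup>2) n k * x ^ k" for n k
  have step: "g (Suc n) (Suc k) = g n (Suc k) - x * (q\<^sup>2) ^ Suc n * g n k" if "k \<le> n" for k
  proof -
    have "q ^ (Suc k * (Suc k + 1)) * (q\<^sup>2) ^ (n - k) = q ^ (k * (k + 1)) * (q\<^sup>2) ^ Suc n"
    proof -
      obtain d where d: "n = k + d" using le_Suc_ex[OF \<open>k \<le> n\<close>] by blast
      have "Suc k * (Suc k + 1) + 2 * (n - k) = k * (k + 1) + 2 * Suc n"
        by (simp add: d algebra_simps)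
      then show ?thesis by (simp only: power_mult [symmetric] power_add [symmetric])
    qed
    moreover have "(-1) ^ Suc k * Q * (P * b) * x ^ Suc k = - x * (Q * P) * ((-1) ^ k * b * x ^ k)"
      for Q P b :: real by simp
    ultimately have "(-1) ^ Suc k * q ^ (Suc k * (Suc k + 1)) * ((q\<^sup>2) ^ (n - k) * qbinom (q\<^sup>2) n k) * x ^ Suc k
       = - x * (q ^ (k * (k + 1)) * (q\<^sup>2) ^ Suc n) * ((-1) ^ k * qbinom (q\<^sup>2) n k * x ^ k)"
      by (simp only:)
    also have "\<dots> = - x * (q\<^sup>2) ^ Suc n * g n k"
      unfolding g_def by (simp only: mult_ac)
    finally have e: "(-1) ^ Suc k * q ^ (Suc k * (Suc k + 1)) * ((q\<^sup>2) ^ (n - k) * qbinom (q\<^sup>2) n k) * x ^ Suc k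
       = - x * (q\<^sup>2) ^ Suc n * g n k" .
    have "g (Suc n) (Suc k) = g n (Suc k)
       + (-1) ^ Suc k * q ^ (Suc k * (Suc k + 1)) * ((q\<^sup>2) ^ (n - k) * qbinom (q\<^sup>2) n k) * x ^ Suc k"
      unfolding g_def qbinom_pascal[OF p that] by (simp only: distrib_left distrib_right)
    then show ?thesis unfolding e by simp
  qed
  have last: "g n (Suc n) = 0" by (simp add: g_def qbinom_def)
  have "(\<Sum>k\<le>Suc n. g (Suc n) k) = g (Suc n) 0 + (\<Sum>k\<le>n. g (Suc n) (Suc k))"
    by (rule sum.atMost_Suc_shift)
  also have "\<dots> = g n 0 + (\<Sum>k\<le>n. g n (Suc k)) - x * (q\<^sup>2) ^ Suc n * (\<Sum>k\<le>n. g n k)"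
  proof -
    have "g (Suc n) 0 = g n 0" using p by (simp add: g_def)
    moreover have "(\<Sum>k\<le>n. g (Suc n) (Suc k)) = (\<Sum>k\<le>n. g n (Suc k)) - (\<Sum>k\<le>n. x * (q\<^sup>2) ^ Suc n * g n k)"
      unfolding sum_subtractf [symmetric] by (intro sum.cong refl step) simp
    ultimately show ?thesis unfolding sum_distrib_left by simp
  qed
  also have "g n 0 + (\<Sum>k\<le>n. g n (Suc k)) = (\<Sum>k\<le>Suc n. g n k)"
    by (rule sum.atMost_Suc_shift [symmetric])
  also have "\<dots> = (\<Sum>k\<le>n. g n k)" by (simp add: last)
  also have "\<dots> - x * (q\<^sup>2) ^ Suc n * (\<Sum>k\<le>n. g n k) = qpoch (x * q\<^sup>2) (q\<^sup>2) (Suc n)"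
    using Suc.IH by (simp add: qpoch_Suc g_def algebra_simps)
  finally show ?case by (simp add: g_def)
qed

section \<open>Bilateral theta series\<close>
lemma suminf_recentre:
  fixes f :: "nat \<Rightarrow> real"
  assumes "summable f"
  shows "summable (\<lambda>j. f (m + j) + (if j < m then f (m - Suc j) else 0))"
    and "suminf f = (\<Sum>j. f (m + j) + (if j < m then f (m - Suc j) else 0))"
proof -
  have right: "summable (\<lambda>j. f (m + j))"
    using summable_ignore_initial_segment[OF assms, of m] by (simp add: add.commute)
  have left: "summable (\<lambda>j. if j < m then f (m - Suc j) else 0)"
    by (rule summable_finite[of "{..<m}"]) auto
  show "summable (\<lambda>j. f (m + j) + (if j < m then f (m - Suc j) else 0))"
    using right left by (rule summable_add)
  have "suminf f = (\<Sum>j. f (m + j)) + (\<Sum>i<m. f i)"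
    using suminf_split_initial_segment[OF assms, of m] by (simp add: add.commute)
  also have "(\<Sum>i<m. f i) = (\<Sum>j<m. f (m - Suc j))"
    by (rule sum.nat_diff_reindex [symmetric])
  also have "\<dots> = (\<Sum>j. if j < m then f (m - Suc j) else 0)"
    by (subst suminf_finite[of "{..<m}"]) auto
  also have "(\<Sum>j. f (m + j)) + \<dots> = (\<Sum>j. f (m + j) + (if j < m then f (m - Suc j) else 0))"
    using right left by (rule suminf_add)
  finally show "suminf f = (\<Sum>j. f (m + j) + (if j < m then f (m - Suc j) else 0))" .
qed

text \<open>The term with index \<open>j\<close> combines the indices \<open>n = j\<close> and \<open>n = - 1 - j\<close> of the bilateral series
  \<open>\<Sum>n. (-1)\<^sup>n q\<^bsup>n(n+1)\<^esup> u(n) y\<^sup>n\<close>. The exponent \<open>n (n + 1)\<close> is the same for both and the signs are opposite,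
  so a sum over the natural numbers suffices.\<close>
definition theta_term :: "(int \<Rightarrow> real) \<Rightarrow> real \<Rightarrow> real \<Rightarrow> nat \<Rightarrow> real" where
  "theta_term u q y j =
     (-1) ^ j * q ^ (j * (j + 1)) * (u (int j) * y ^ j - u (- 1 - int j) * (1 / y) ^ (j + 1))"

definition theta_series :: "(int \<Rightarrow> real) \<Rightarrow> real \<Rightarrow> real \<Rightarrow> real" where
  "theta_series u q y = (\<Sum>j. theta_term u q y j)"

text \<open>The growth class contains all coefficients that occur: bounded ones (the theta function and its finite versions), \<open>n\<close>
  (the Euler derivative), and the errors committed when weights are replaced by their limit.\<close>
definition linear_growth :: "real \<Rightarrow> (int \<Rightarrow> real) \<Rightarrow> bool" where
  "linear_growth K u \<longleftrightarrow> (\<forall>n. \<bar>u n\<bar> \<le> K * (1 + \<bar>of_int n\<bar>))"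

lemma linear_growth_nonneg: "linear_growth K u \<Longrightarrow> 0 \<le> K"
  unfolding linear_growth_def by (drule spec[of _ 0]) auto

lemma linear_growth_bounded:
  assumes "\<And>n. \<bar>u n\<bar> \<le> K"
  shows "linear_growth K u"
  unfolding linear_growth_def
proof
  fix n
  have "0 \<le> K" using assms[of 0] by linarith
  then have "K * 1 \<le> K * (1 + \<bar>of_int n\<bar>)" by (intro mult_left_mono) auto
  with assms[of n] show "\<bar>u n\<bar> \<le> K * (1 + \<bar>of_int n\<bar>)" by simp
qed

lemma summable_gaussian:
  fixes q x :: real
  assumes q: "0 < q" "q < 1"
  shows "summable (\<lambda>k. (real k + 2) * q ^ (k * (k + 1)) * x ^ k)"
proof -
  define f where "f k = (real k + 2) * q ^ (k * (k + 1)) * x ^ k" for k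
  have "(\<lambda>k. 2 * (q ^ k * q ^ k * q\<^sup>2 * \<bar>x\<bar>)) \<longlonglongrightarrow> 2 * (0 * 0 * q\<^sup>2 * \<bar>x\<bar>)"
    using q by (intro tendsto_intros LIMSEQ_power_zero) auto
  then have "\<forall>\<^sub>F k in sequentially. 2 * (q ^ k * q ^ k * q\<^sup>2 * \<bar>x\<bar>) < 1 / 2"
    by (rule order_tendstoD) simp
  then obtain N where N: "\<And>k. k \<ge> N \<Longrightarrow> 2 * (q ^ k * q ^ k * q\<^sup>2 * \<bar>x\<bar>) < 1 / 2"
    unfolding eventually_sequentially by blast
  have "summable f"
  proof (rule summable_ratio_test[where c = "1/2" and N = N])
    fix k assume "k \<ge> N"
    have "q ^ (Suc k * (Suc k + 1)) = q ^ (k * (k + 1)) * (q ^ k * q ^ k * q\<^sup>2)"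
      by (simp flip: power_add) (simp add: algebra_simps power2_eq_square)
    then have "norm (f (Suc k)) = (real k + 3) * (q ^ (k * (k + 1)) * (q ^ k * q ^ k * q\<^sup>2)) * \<bar>x\<bar> ^ Suc k"
      using q unfolding f_def by (simp add: abs_mult power_abs)
    also have "\<dots> \<le> (2 * (real k + 2)) * (q ^ (k * (k + 1)) * (q ^ k * q ^ k * q\<^sup>2)) * \<bar>x\<bar> ^ Suc k"
      using q by (intro mult_right_mono) auto
    also have "\<dots> = (2 * (q ^ k * q ^ k * q\<^sup>2 * \<bar>x\<bar>)) * ((real k + 2) * q ^ (k * (k + 1)) * \<bar>x\<bar> ^ k)"
      by (simp only: power_Suc mult_ac)
    also have "\<dots> \<le> 1 / 2 * ((real k + 2) * q ^ (k * (k + 1)) * \<bar>x\<bar> ^ k)"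
      using q N[OF \<open>k \<ge> N\<close>] by (intro mult_right_mono) auto
    also have "\<dots> = 1 / 2 * norm (f k)"
      using q unfolding f_def by (simp add: abs_mult power_abs)
    finally show "norm (f (Suc k)) \<le> 1 / 2 * norm (f k)" .
  qed simp
  then show ?thesis unfolding f_def .
qed

text \<open>A majorant that is uniform for \<open>y\<close> between \<open>q\<^sup>2\<close> and \<open>1\<close>: there \<open>1 / y\<close> is at most \<open>1 / q\<^sup>2\<close>, and \<open>j + 2\<close>
  absorbs linear growth at both indices \<open>j\<close> and \<open>- 1 - j\<close>.\<close>
definition theta_majorant :: "real \<Rightarrow> nat \<Rightarrow> real" where
  "theta_majorant q j = (real j + 2) * q ^ (j * (j + 1)) * (1 / q\<^sup>2) ^ (j + 1)"

lemma summable_theta_majorant: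
  assumes "0 < q" "q < 1"
  shows "summable (theta_majorant q)"
proof -
  have "summable (\<lambda>j. (1 / q\<^sup>2) * ((real j + 2) * q ^ (j * (j + 1)) * (1 / q\<^sup>2) ^ j))"
    using assms by (intro summable_mult summable_gaussian)
  moreover have "theta_majorant q = (\<lambda>j. (1 / q\<^sup>2) * ((real j + 2) * q ^ (j * (j + 1)) * (1 / q\<^sup>2) ^ j))"
    by (simp add: theta_majorant_def fun_eq_iff)
  ultimately show ?thesis by simp
qed

lemma theta_term_bound_pointwise:
  assumes q: "0 < q" "q < 1" and y: "q\<^sup>2 \<le> y" "y \<le> 1"
  shows "\<bar>theta_term u q y j\<bar> \<le> q ^ (j * (j + 1)) * (1 / q\<^sup>2) ^ (j + 1) * (\<bar>u (int j)\<bar> + \<bar>u (- 1 - int j)\<bar>)"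
proof -
  have q2: "0 < q\<^sup>2" "q\<^sup>2 < 1" using q by (auto simp: power_less_one_iff)
  then have y0: "0 < y" using y by linarith
  have "y ^ j \<le> 1" using y y0 by (simp add: power_le_one)
  moreover have "1 \<le> (1 / q\<^sup>2) ^ (j + 1)" using q2 by (intro one_le_power) simp
  ultimately have A: "y ^ j \<le> (1 / q\<^sup>2) ^ (j + 1)" by linarith
  have B: "(1 / y) ^ (j + 1) \<le> (1 / q\<^sup>2) ^ (j + 1)"
    using q2 y y0 by (intro power_mono frac_le) auto
  have "\<bar>u (int j) * y ^ j - u (- 1 - int j) * (1 / y) ^ (j + 1)\<bar>
          \<le> \<bar>u (int j)\<bar> * y ^ j + \<bar>u (- 1 - int j)\<bar> * (1 / y) ^ (j + 1)"
    using abs_triangle_ineq4[of "u (int j) * y ^ j" "u (- 1 - int j) * (1 / y) ^ (j + 1)"] y0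
    by (simp add: abs_mult)
  also have "\<dots> \<le> \<bar>u (int j)\<bar> * (1 / q\<^sup>2) ^ (j + 1) + \<bar>u (- 1 - int j)\<bar> * (1 / q\<^sup>2) ^ (j + 1)"
    by (intro add_mono mult_left_mono A B) auto
  finally have "q ^ (j * (j + 1)) * \<bar>u (int j) * y ^ j - u (- 1 - int j) * (1 / y) ^ (j + 1)\<bar>
     \<le> q ^ (j * (j + 1)) * (\<bar>u (int j)\<bar> * (1 / q\<^sup>2) ^ (j + 1) + \<bar>u (- 1 - int j)\<bar> * (1 / q\<^sup>2) ^ (j + 1))"
    using q by (intro mult_left_mono) auto
  moreover have "\<bar>theta_term u q y j\<bar> = q ^ (j * (j + 1)) * \<bar>u (int j) * y ^ j - u (- 1 - int j) * (1 / y) ^ (j + 1)\<bar>"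
    using q by (simp add: theta_term_def abs_mult power_abs)
  ultimately show ?thesis by (simp only: distrib_left mult_ac)
qed

lemma theta_term_bound:
  assumes "0 < q" "q < 1" "q\<^sup>2 \<le> y" "y \<le> 1" and u: "linear_growth K u"
  shows "\<bar>theta_term u q y j\<bar> \<le> 2 * K * theta_majorant q j"
proof -
  have K: "0 \<le> K" using u by (rule linear_growth_nonneg)
  have "\<bar>u (int j)\<bar> \<le> K * (1 + \<bar>of_int (int j)\<bar>)" "\<bar>u (- 1 - int j)\<bar> \<le> K * (1 + \<bar>of_int (- 1 - int j)\<bar>)"
    using u unfolding linear_growth_def by blast+
  then have "\<bar>u (int j)\<bar> + \<bar>u (- 1 - int j)\<bar> \<le> 2 * K * (real j + 2)"
    using K by (simp add: algebra_simps)
  then have "q ^ (j * (j + 1)) * (1 / q\<^sup>2) ^ (j + 1) * (\<bar>u (int j)\<bar> + \<bar>u (- 1 - int j)\<bar>)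
     \<le> q ^ (j * (j + 1)) * (1 / q\<^sup>2) ^ (j + 1) * (2 * K * (real j + 2))"
    using assms by (intro mult_left_mono) auto
  also have "\<dots> = 2 * K * theta_majorant q j"
    unfolding theta_majorant_def by (simp only: mult_ac)
  finally show ?thesis using theta_term_bound_pointwise[OF assms(1-4), of u j] by linarith
qed

lemma summable_theta_term:
  assumes "0 < q" "q < 1" "q\<^sup>2 \<le> y" "y \<le> 1" "linear_growth K u"
  shows "summable (theta_term u q y)"
proof (rule summable_comparison_test')
  show "summable (\<lambda>j. 2 * K * theta_majorant q j)"
    using assms by (intro summable_mult summable_theta_majorant)
  show "norm (theta_term u q y j) \<le> 2 * K * theta_majorant q j" if "j \<ge> 0" for j
    using theta_term_bound[OF assms] by simp
qed

lemma theta_series_lincomb: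
  assumes "0 < q" "q < 1" "q\<^sup>2 \<le> y" "y \<le> 1" and u: "linear_growth K u" and v: "linear_growth L v"
  shows "theta_series (\<lambda>n. a * u n + b * v n) q y = a * theta_series u q y + b * theta_series v q y"
proof -
  have "theta_term (\<lambda>n. a * u n + b * v n) q y = (\<lambda>j. a * theta_term u q y j + b * theta_term v q y j)"
    by (simp add: theta_term_def fun_eq_iff algebra_simps)
  then show ?thesis
    using summable_theta_term[OF assms(1-4) u] summable_theta_term[OF assms(1-4) v]
    by (simp add: theta_series_def suminf_add [symmetric] suminf_mult summable_mult)
qed

text \<open>Dominated convergence. Since the bound is uniform in \<open>y\<close>, the point may move
  with \<open>m\<close> in an arbitrary way, which is essential because \<open>\<theta>\<^sub>m\<close> need not converge.\<close>
lemma theta_series_tendsto_0: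
  assumes q: "0 < q" "q < 1" and y: "\<And>m. q\<^sup>2 \<le> y m" "\<And>m. y m \<le> 1"
    and u: "\<And>m. linear_growth K (u m)" and lim: "\<And>n. (\<lambda>m. u m n) \<longlonglongrightarrow> 0"
  shows "(\<lambda>m. theta_series (u m) q (y m)) \<longlonglongrightarrow> 0"
proof -
  have "(\<lambda>m. \<Sum>j. theta_term (u m) q (y m) j) \<longlonglongrightarrow> (\<Sum>j. 0)"
  proof (rule conjunct2[OF conjunct2[OF tannerys_theorem]])
    fix j
    show "(\<lambda>m. theta_term (u m) q (y m) j) \<longlonglongrightarrow> 0"
    proof (rule Lim_null_comparison)
      show "\<forall>\<^sub>F m in sequentially. norm (theta_term (u m) q (y m) j)
          \<le> q ^ (j * (j + 1)) * (1 / q\<^sup>2) ^ (j + 1) * (\<bar>u m (int j)\<bar> + \<bar>u m (- 1 - int j)\<bar>)"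
        using theta_term_bound_pointwise[OF q y] by simp
      have "(\<lambda>m. q ^ (j * (j + 1)) * (1 / q\<^sup>2) ^ (j + 1) * (\<bar>u m (int j)\<bar> + \<bar>u m (- 1 - int j)\<bar>))
          \<longlonglongrightarrow> q ^ (j * (j + 1)) * (1 / q\<^sup>2) ^ (j + 1) * (\<bar>0\<bar> + \<bar>0\<bar>)"
        by (intro tendsto_mult tendsto_const tendsto_add tendsto_rabs lim)
      then show "(\<lambda>m. q ^ (j * (j + 1)) * (1 / q\<^sup>2) ^ (j + 1) * (\<bar>u m (int j)\<bar> + \<bar>u m (- 1 - int j)\<bar>)) \<longlonglongrightarrow> 0"
        by simp
    qed
  next
    show "\<forall>\<^sub>F (j, m) in sequentially \<times>\<^sub>F sequentially.
        norm (theta_term (u m) q (y m) j) \<le> 2 * K * theta_majorant q j"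
      using theta_term_bound[OF q y u] by (simp add: case_prod_unfold)
    show "summable (\<lambda>j. 2 * K * theta_majorant q j)"
      using q by (intro summable_mult summable_theta_majorant)
  qed simp
  then show ?thesis by (simp add: theta_series_def)
qed

definition shifted_coeff :: "nat \<Rightarrow> (nat \<Rightarrow> real) \<Rightarrow> int \<Rightarrow> real" where
  "shifted_coeff m g n = (if 0 \<le> int m + n then g (nat (int m + n)) else 0)"

text \<open>Substituting \<open>k = m + n\<close> completes the square: \<open>k (k + 1) - 2 m k = n (n + 1) + m - m\<^sup>2\<close>. The last two
  terms do not depend on \<open>n\<close> and make up the prefactor.\<close>
lemma suminf_eq_theta_series:
  fixes q y :: real
  assumes q: "0 < q" and y: "0 < y"
    and sm: "summable (\<lambda>k. (-1) ^ k * q ^ (k * (k + 1)) * g k * (y / (q\<^sup>2) ^ m) ^ k)"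
  shows "(\<Sum>k. (-1) ^ k * q ^ (k * (k + 1)) * g k * (y / (q\<^sup>2) ^ m) ^ k)
       = (-1) ^ m * ((q * y) ^ m / q ^ (m * m)) * theta_series (shifted_coeff m g) q y"
proof -
  define f where "f k = (-1) ^ k * q ^ (k * (k + 1)) * g k * (y / (q\<^sup>2) ^ m) ^ k" for k
  define C where "C = (-1) ^ m * ((q * y) ^ m / q ^ (m * m))"
  have f: "f k = (-1) ^ k * (q ^ (k * (k + 1)) / q ^ (2 * m * k)) * y ^ k * g k" for k
    by (simp add: f_def power_divide flip: power_mult)
  have right: "f (m + j) = C * ((-1) ^ j * q ^ (j * (j + 1)) * (g (m + j) * y ^ j))" for j
  proof -
    have "q ^ ((m + j) * (m + j + 1)) * q ^ (m * m) = q ^ m * q ^ (j * (j + 1)) * q ^ (2 * m * (m + j))"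
      unfolding power_add [symmetric] by (rule arg_cong[where f = "power q"]) (simp add: algebra_simps)
    then have "q ^ ((m + j) * (m + j + 1)) / q ^ (2 * m * (m + j)) = q ^ m * q ^ (j * (j + 1)) / q ^ (m * m)"
      using q by (simp add: frac_eq_eq)
    then show ?thesis unfolding f C_def
      by (simp only: power_add power_mult_distrib) (simp add: mult_ac)
  qed
  have left: "f (m - Suc j) = - C * ((-1) ^ j * q ^ (j * (j + 1)) * (g (m - Suc j) * (1 / y) ^ (j + 1)))"
    if "j < m" for j
  proof -
    obtain d where d: "m = Suc j + d" using \<open>j < m\<close> by (metis less_iff_Suc_add add_Suc)
    have "q ^ (d * (d + 1)) * q ^ (m * m) = q ^ m * q ^ (j * (j + 1)) * q ^ (2 * m * d)"
      unfolding power_add [symmetric] by (rule arg_cong[where f = "power q"]) (simp add: d algebra_simps)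
    then have "q ^ (d * (d + 1)) / q ^ (2 * m * d) = q ^ m * q ^ (j * (j + 1)) / q ^ (m * m)"
      using q by (simp add: frac_eq_eq)
    moreover have "y ^ d = y ^ m * (1 / y) ^ (j + 1)"
      using y by (simp add: d power_add power_one_over field_simps)
    moreover have "(-1) ^ d = - ((-1::real) ^ m * (-1) ^ j)"
      by (simp add: d power_add)
    moreover have "m - Suc j = d" using d by simp
    ultimately show ?thesis unfolding f C_def by (simp add: power_mult_distrib mult_ac)
  qed
  have "f (m + j) + (if j < m then f (m - Suc j) else 0) = C * theta_term (shifted_coeff m g) q y j" for j
  proof (cases "j < m")
    case True
    then have ix: "0 \<le> int m + int j" "nat (int m + int j) = m + j"
      "0 \<le> int m + (- 1 - int j)" "nat (int m + (- 1 - int j)) = m - Suc j" by auto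
    have "theta_term (shifted_coeff m g) q y j
        = (-1) ^ j * q ^ (j * (j + 1)) * (g (m + j) * y ^ j - g (m - Suc j) * (1 / y) ^ (j + 1))"
      by (simp only: theta_term_def shifted_coeff_def ix if_True)
    then show ?thesis unfolding right left[OF True] if_P[OF True]
      by (simp only: right_diff_distrib mult_minus_left add_uminus_conv_diff)
  next
    case False
    then have "\<not> 0 \<le> int m + (- 1 - int j)" "nat (int m + int j) = m + j" by auto
    with False show ?thesis by (simp add: right theta_term_def shifted_coeff_def)
  qed
  then have e: "suminf f = (\<Sum>j. C * theta_term (shifted_coeff m g) q y j)"
    and s: "summable (\<lambda>j. C * theta_term (shifted_coeff m g) q y j)"
    using suminf_recentre[of f m] sm unfolding f_def [symmetric] by simp_all
  have "C \<noteq> 0" using q y by (simp add: C_def)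
  then have "summable (theta_term (shifted_coeff m g) q y)"
    using s summable_mult_D by blast
  then have "suminf f = C * theta_series (shifted_coeff m g) q y"
    using e by (simp add: suminf_mult theta_series_def)
  then show ?thesis unfolding f_def C_def .
qed

section \<open>The Jacobi triple product\<close>
lemma qbinom_bounds:
  assumes p: "0 < p" "p < 1"
  shows "\<bar>qbinom p n k\<bar> \<le> 1 / (qpoch_inf p p)\<^sup>2"
proof (cases "k \<le> n")
  case True
  have pos: "0 < qpoch_inf p p" "\<And>i. 0 < qpoch p p i" using p by (auto intro: qpoch_inf_pos qpoch_pos)
  have le: "qpoch_inf p p \<le> qpoch p p i" for i using p by (intro qpoch_inf_le) auto
  have "qpoch p p n / (qpoch p p k * qpoch p p (n - k)) \<le> 1 / (qpoch_inf p p * qpoch_inf p p)"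
    using p pos by (intro frac_le mult_mono le qpoch_bounds(2)) (auto intro: less_imp_le)
  then show ?thesis using True pos less_imp_le[OF pos(2)]
    by (simp add: qbinom_def power2_eq_square)
qed (simp add: qbinom_def)

text \<open>The product over the exponents \<open>- N, ..., N\<close>. Each factor with a negative exponent is reflected by
  \<open>1 - y / p ^ i = - (y / p ^ i) (1 - p ^ i / y)\<close>, where \<open>p = q\<^sup>2\<close>.\<close>
lemma qpoch_symmetric_product:
  assumes q: "0 < q" "q < 1" and y: "0 < y"
  shows "qpoch (y / (q\<^sup>2) ^ N) (q\<^sup>2) (2 * N + 1)
       = (-1) ^ N * y ^ N / q ^ (N * (N + 1)) * (1 - y) * (qpoch (q\<^sup>2 / y) (q\<^sup>2) N * qpoch (y * q\<^sup>2) (q\<^sup>2) N)"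
proof (induction N)
  case 0
  then show ?case by (simp add: qpoch_def)
next
  case (Suc N)
  have "qpoch (y / (q\<^sup>2) ^ Suc N) (q\<^sup>2) (2 * Suc N + 1)
     = (1 - y / (q\<^sup>2) ^ Suc N) * (qpoch (y / (q\<^sup>2) ^ N) (q\<^sup>2) (2 * N + 1) * (1 - y / (q\<^sup>2) ^ N * (q\<^sup>2) ^ (2 * N + 1)))"
  proof -
    have "2 * Suc N + 1 = Suc (Suc (2 * N + 1))" by simp
    moreover have "y / (q\<^sup>2) ^ Suc N * q\<^sup>2 = y / (q\<^sup>2) ^ N" using q by simp
    ultimately show ?thesis by (simp only: qpoch_Suc_shift[of _ _ "Suc (2 * N + 1)"] qpoch_Suc[of _ _ "2 * N + 1"])
  qed
  also have "y / (q\<^sup>2) ^ N * (q\<^sup>2) ^ (2 * N + 1) = y * q\<^sup>2 * (q\<^sup>2) ^ N"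
    using q by (simp add: mult_2 power_add)
  also have "1 - y / (q\<^sup>2) ^ Suc N = - (y / (q\<^sup>2) ^ Suc N) * (1 - q\<^sup>2 / y * (q\<^sup>2) ^ N)"
    using q y by (simp add: field_simps)
  finally have "qpoch (y / (q\<^sup>2) ^ Suc N) (q\<^sup>2) (2 * Suc N + 1)
     = - (y / (q\<^sup>2) ^ Suc N) * (1 - q\<^sup>2 / y * (q\<^sup>2) ^ N)
       * ((-1) ^ N * y ^ N / q ^ (N * (N + 1)) * (1 - y) * (qpoch (q\<^sup>2 / y) (q\<^sup>2) N * qpoch (y * q\<^sup>2) (q\<^sup>2) N)
       * (1 - y * q\<^sup>2 * (q\<^sup>2) ^ N))"
    by (simp only: Suc.IH)
  also have "\<dots> = - (y / (q\<^sup>2) ^ Suc N) * ((-1) ^ N * y ^ N / q ^ (N * (N + 1))) * (1 - y)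
       * (qpoch (q\<^sup>2 / y) (q\<^sup>2) (Suc N) * qpoch (y * q\<^sup>2) (q\<^sup>2) (Suc N))"
    by (simp only: qpoch_Suc mult_ac)
  also have "- (y / (q\<^sup>2) ^ Suc N) * ((-1) ^ N * y ^ N / q ^ (N * (N + 1))) = (-1) ^ Suc N * y ^ Suc N / q ^ (Suc N * (Suc N + 1))"
  proof -
    have "(q\<^sup>2) ^ Suc N * q ^ (N * (N + 1)) = q ^ (Suc N * (Suc N + 1))"
      unfolding power_mult [symmetric] power_add [symmetric] by (rule arg_cong[where f = "power q"]) simp
    then show ?thesis unfolding minus_divide_left times_divide_times_eq by simp
  qed
  finally show ?case .
qed

text \<open>Rothe's identity with \<open>2 N + 1\<close> factors, recentred at \<open>N + 1\<close>. An odd number of factors makes the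
  Gaussian binomial coefficients symmetric under \<open>n \<mapsto> - 1 - n\<close>, like the terms of the theta series.\<close>
lemma finite_triple_product:
  assumes q: "0 < q" "q < 1" and y: "0 < y"
  shows "theta_series (shifted_coeff (N + 1) (qbinom (q\<^sup>2) (2 * N + 1))) q y
       = (1 - 1 / y) * (qpoch (q\<^sup>2 / y) (q\<^sup>2) N * qpoch (y * q\<^sup>2) (q\<^sup>2) N)"
proof -
  define M where "M = N + 1"
  define f where "f k = (-1) ^ k * q ^ (k * (k + 1)) * qbinom (q\<^sup>2) (2 * N + 1) k * (y / (q\<^sup>2) ^ M) ^ k" for k
  have z: "f k = 0" if "k \<notin> {..2 * N + 1}" for k
    using that by (simp add: f_def qbinom_def)
  have sm: "summable f" by (rule summable_finite[of "{..2 * N + 1}"]) (simp_all add: z)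
  have "y / (q\<^sup>2) ^ N = y / (q\<^sup>2) ^ M * q\<^sup>2" using q by (simp add: M_def)
  then have "qpoch (y / (q\<^sup>2) ^ N) (q\<^sup>2) (2 * N + 1) = (\<Sum>k\<le>2 * N + 1. f k)"
    unfolding f_def using rothe_identity[OF q, of "y / (q\<^sup>2) ^ M" "2 * N + 1"] by (simp only:)
  also have "\<dots> = suminf f" by (rule suminf_finite[of "{..2 * N + 1}", symmetric]) (simp_all add: z)
  also have "\<dots> = (-1) ^ M * ((q * y) ^ M / q ^ (M * M)) * theta_series (shifted_coeff M (qbinom (q\<^sup>2) (2 * N + 1))) q y"
    unfolding f_def by (rule suminf_eq_theta_series[OF q(1) y sm[unfolded f_def]])
  also have "(q * y) ^ M / q ^ (M * M) = y ^ N * y / q ^ (N * (N + 1))"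
  proof -
    have "q ^ (M * M) = q ^ M * q ^ (N * (N + 1))"
      unfolding power_add [symmetric] by (rule arg_cong[where f = "power q"]) (simp add: M_def)
    then show ?thesis using q by (simp add: power_mult_distrib M_def)
  qed
  finally have "(-1) ^ N * y ^ N / q ^ (N * (N + 1)) * (- y * theta_series (shifted_coeff M (qbinom (q\<^sup>2) (2 * N + 1))) q y)
     = (-1) ^ N * y ^ N / q ^ (N * (N + 1)) * ((1 - y) * (qpoch (q\<^sup>2 / y) (q\<^sup>2) N * qpoch (y * q\<^sup>2) (q\<^sup>2) N))"
    unfolding qpoch_symmetric_product[OF q y] by (simp add: M_def mult_ac)
  moreover have "(-1) ^ N * y ^ N / q ^ (N * (N + 1)) \<noteq> 0" using q y by simp
  ultimately have "- y * theta_series (shifted_coeff M (qbinom (q\<^sup>2) (2 * N + 1))) q y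
     = (1 - y) * (qpoch (q\<^sup>2 / y) (q\<^sup>2) N * qpoch (y * q\<^sup>2) (q\<^sup>2) N)"
    using mult_left_cancel by blast
  then show ?thesis using y by (simp add: M_def field_simps)
qed

lemma filterlim_nat_shift:
  assumes "filterlim a sequentially F"
  shows "filterlim (\<lambda>m. nat (int (a m) + n)) sequentially F"
  unfolding filterlim_at_top
proof
  fix Z
  have "\<forall>\<^sub>F m in F. Z + nat \<bar>n\<bar> \<le> a m" using assms unfolding filterlim_at_top by blast
  then show "\<forall>\<^sub>F m in F. Z \<le> nat (int (a m) + n)" by (rule eventually_mono) linarith
qed

lemma shifted_coeff_qbinom_LIMSEQ:
  assumes p: "0 < p" "p < 1"
  shows "(\<lambda>N. shifted_coeff (N + 1) (qbinom p (2 * N + 1)) n) \<longlonglongrightarrow> 1 / qpoch_inf p p"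
proof (rule Lim_transform_eventually)
  have nz: "qpoch_inf p p \<noteq> 0" using qpoch_inf_pos[of p p] p by simp
  have L: "filterlim (\<lambda>N. N + 1) sequentially sequentially" "filterlim (\<lambda>N. N) sequentially sequentially"
    by (auto simp: filterlim_ident filterlim_Suc)
  have "filterlim (\<lambda>N. 2 * N + 1 :: nat) sequentially sequentially"
    by (rule filterlim_subseq) (simp add: strict_mono_def)
  then have "(\<lambda>N. qpoch p p (2 * N + 1) / (qpoch p p (nat (int (N + 1) + n)) * qpoch p p (nat (int N + (- n)))))
      \<longlonglongrightarrow> qpoch_inf p p / (qpoch_inf p p * qpoch_inf p p)"
    using nz filterlim_nat_shift[OF L(1), of n] filterlim_nat_shift[OF L(2), of "- n"]
    by (intro tendsto_divide tendsto_mult filterlim_compose[OF qpoch_LIMSEQ[OF p]]) auto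
  then show "(\<lambda>N. qpoch p p (2 * N + 1) / (qpoch p p (nat (int (N + 1) + n)) * qpoch p p (nat (int N + (- n)))))
      \<longlonglongrightarrow> 1 / qpoch_inf p p"
    using nz by simp
  show "\<forall>\<^sub>F N in sequentially. qpoch p p (2 * N + 1) / (qpoch p p (nat (int (N + 1) + n)) * qpoch p p (nat (int N + (- n))))
      = shifted_coeff (N + 1) (qbinom p (2 * N + 1)) n"
    using eventually_ge_at_top[of "nat \<bar>n\<bar>"]
  proof (rule eventually_mono)
    fix N assume "nat \<bar>n\<bar> \<le> N"
    then have "0 \<le> int (N + 1) + n" "nat (int (N + 1) + n) \<le> 2 * N + 1"
      "2 * N + 1 - nat (int (N + 1) + n) = nat (int N + (- n))" by linarith+
    then show "qpoch p p (2 * N + 1) / (qpoch p p (nat (int (N + 1) + n)) * qpoch p p (nat (int N + (- n))))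
      = shifted_coeff (N + 1) (qbinom p (2 * N + 1)) n"
      by (simp only: shifted_coeff_def qbinom_def if_True)
  qed
qed

text \<open>Let \<open>N\<close> tend to infinity in the finite version. The Gaussian binomial coefficients are bounded and each of them
  tends to \<open>1 / (p;p)\<^sub>\<infinity>\<close>, where \<open>p = q\<^sup>2\<close>, so dominated convergence applies to the series side.\<close>
theorem jacobi_triple_product:
  assumes q: "0 < q" "q < 1" and y: "q\<^sup>2 \<le> y" "y \<le> 1"
  shows "theta_series (\<lambda>_. 1) q y
       = (1 - 1 / y) * qpoch_inf (q\<^sup>2) (q\<^sup>2) * qpoch_inf (q\<^sup>2 / y) (q\<^sup>2) * qpoch_inf (y * q\<^sup>2) (q\<^sup>2)"
proof -
  have p: "0 < q\<^sup>2" "q\<^sup>2 < 1" using q by (auto simp: power_less_one_iff)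
  then have y0: "0 < y" using y by linarith
  define L where "L = qpoch_inf (q\<^sup>2) (q\<^sup>2)"
  have L: "0 < L" unfolding L_def using p by (intro qpoch_inf_pos) auto
  define u where "u N = shifted_coeff (N + 1) (qbinom (q\<^sup>2) (2 * N + 1))" for N
  have ub: "\<bar>u N n\<bar> \<le> 1 / L\<^sup>2" for N n
    using qbinom_bounds[OF p] by (simp add: u_def shifted_coeff_def L_def)
  have lg: "linear_growth (1 / L\<^sup>2) (u N)" for N by (rule linear_growth_bounded) (rule ub)
  have lg1: "linear_growth 1 (\<lambda>_. 1)" by (rule linear_growth_bounded) simp
  have e: "theta_series (\<lambda>n. 1 * u N n + (- 1 / L) * 1) q y = 1 * theta_series (u N) q y + (- 1 / L) * theta_series (\<lambda>_. 1) q y" for N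
    by (rule theta_series_lincomb[OF q y lg lg1])
  have "(\<lambda>N. theta_series (\<lambda>n. 1 * u N n + (- 1 / L) * 1) q y) \<longlonglongrightarrow> 0"
  proof (rule theta_series_tendsto_0[OF q y])
    fix N
    show "linear_growth (1 / L\<^sup>2 + 1 / L) (\<lambda>n. 1 * u N n + (- 1 / L) * 1)"
    proof (rule linear_growth_bounded)
      fix n
      show "\<bar>1 * u N n + (- 1 / L) * 1\<bar> \<le> 1 / L\<^sup>2 + 1 / L"
        using ub[of N n] L abs_triangle_ineq[of "u N n" "- 1 / L"] by simp
    qed
  next
    fix n
    have "(\<lambda>N. 1 * u N n + (- 1 / L) * 1) \<longlonglongrightarrow> 1 * (1 / L) + (- 1 / L) * 1"
      unfolding u_def L_def by (intro tendsto_add tendsto_mult tendsto_const shifted_coeff_qbinom_LIMSEQ p)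
    then show "(\<lambda>N. 1 * u N n + (- 1 / L) * 1) \<longlonglongrightarrow> 0" by simp
  qed
  then have "(\<lambda>N. (theta_series (u N) q y + (- 1 / L) * theta_series (\<lambda>_. 1) q y) + 1 / L * theta_series (\<lambda>_. 1) q y)
      \<longlonglongrightarrow> 0 + 1 / L * theta_series (\<lambda>_. 1) q y"
    unfolding e by (intro tendsto_add tendsto_const) simp
  then have A: "(\<lambda>N. theta_series (u N) q y) \<longlonglongrightarrow> theta_series (\<lambda>_. 1) q y / L"
    by simp
  have "(\<lambda>N. (1 - 1 / y) * (qpoch (q\<^sup>2 / y) (q\<^sup>2) N * qpoch (y * q\<^sup>2) (q\<^sup>2) N))
      \<longlonglongrightarrow> (1 - 1 / y) * (qpoch_inf (q\<^sup>2 / y) (q\<^sup>2) * qpoch_inf (y * q\<^sup>2) (q\<^sup>2))"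
    by (intro tendsto_mult tendsto_const qpoch_LIMSEQ p)
  then have "(\<lambda>N. theta_series (u N) q y) \<longlonglongrightarrow> (1 - 1 / y) * (qpoch_inf (q\<^sup>2 / y) (q\<^sup>2) * qpoch_inf (y * q\<^sup>2) (q\<^sup>2))"
    unfolding u_def finite_triple_product[OF q y0] .
  with A have "theta_series (\<lambda>_. 1) q y / L = (1 - 1 / y) * (qpoch_inf (q\<^sup>2 / y) (q\<^sup>2) * qpoch_inf (y * q\<^sup>2) (q\<^sup>2))"
    using LIMSEQ_unique by blast
  then show ?thesis using L unfolding L_def by (simp add: field_simps)
qed

text \<open>In the triple product \<open>(yp;p)\<^sub>\<infinity>\<close> lies between \<open>(p;p)\<^sub>\<infinity>\<close> and \<open>1\<close>, and splitting off one factor,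
  \<open>(p/y;p)\<^sub>\<infinity> = (1 - p/y) (p\<^sup>2/y;p)\<^sub>\<infinity>\<close>, exposes the zero at \<open>y = p = q\<^sup>2\<close> with a cofactor that is at least
  \<open>(p;p)\<^sub>\<infinity>\<close>.\<close>
lemma jacobi_theta_bounds:
  assumes q: "0 < q" "q < 1" and y: "q\<^sup>2 \<le> y" "y \<le> 1"
  shows "theta_series (\<lambda>_. 1) q y \<le> - (qpoch_inf (q\<^sup>2) (q\<^sup>2) ^ 3 * ((1 - y) * (y - q\<^sup>2)))"
    and "- ((1 - y) / q\<^sup>2) \<le> theta_series (\<lambda>_. 1) q y"
proof -
  have p: "0 < q\<^sup>2" "q\<^sup>2 < 1" using q by (auto simp: power_less_one_iff)
  then have y0: "0 < y" using y by linarith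
  define L where "L = qpoch_inf (q\<^sup>2) (q\<^sup>2)"
  define A where "A = qpoch_inf (q\<^sup>2 / y) (q\<^sup>2)"
  define B where "B = qpoch_inf (y * q\<^sup>2) (q\<^sup>2)"
  have T: "theta_series (\<lambda>_. 1) q y = - ((1 - y) / y * (L * A * B))"
    unfolding jacobi_triple_product[OF q y] L_def A_def B_def using y0 by (simp add: field_simps)
  have L: "0 < L" "L \<le> 1"
    unfolding L_def using p qpoch_inf_le[of "q\<^sup>2" "q\<^sup>2" 0] by (auto intro: qpoch_inf_pos)
  have py: "q\<^sup>2 / y \<le> 1" "0 \<le> q\<^sup>2 / y" using y y0 by auto
  have yp: "y * q\<^sup>2 \<le> q\<^sup>2" "0 \<le> y * q\<^sup>2" using y p mult_pos_pos[OF y0 p(1)] by (auto simp: mult_le_cancel_right1 simp del: zero_less_power2 mult_pos_pos)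
  have yp1: "y * q\<^sup>2 \<le> 1" using yp(1) p(2) by linarith
  have B: "L \<le> B"
    unfolding L_def B_def using p by (intro qpoch_inf_antimono yp) auto
  have B1: "B \<le> 1"
    unfolding B_def using qpoch_inf_le[OF yp(2) yp1 p, of 0] by simp
  have A1: "A \<le> 1" "0 \<le> A"
    unfolding A_def using p py qpoch_inf_le[of "q\<^sup>2 / y" "q\<^sup>2" 0] by (auto intro: qpoch_inf_nonneg)
  have "A = (1 - q\<^sup>2 / y) * qpoch_inf (q\<^sup>2 / y * q\<^sup>2) (q\<^sup>2)"
    unfolding A_def using p by (intro qpoch_inf_shift)
  moreover have "L \<le> qpoch_inf (q\<^sup>2 / y * q\<^sup>2) (q\<^sup>2)"
    unfolding L_def
  proof (rule qpoch_inf_antimono)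
    show "0 \<le> q\<^sup>2 / y * q\<^sup>2" by (intro mult_nonneg_nonneg py less_imp_le p)
    show "q\<^sup>2 / y * q\<^sup>2 \<le> q\<^sup>2" using mult_right_mono[OF py(1) less_imp_le[OF p(1)]] by simp
  qed (use p in simp_all)
  ultimately have A2: "(1 - q\<^sup>2 / y) * L \<le> A"
    using py by (simp add: mult_left_mono)
  have "(y - q\<^sup>2) * L \<le> (1 - q\<^sup>2 / y) * L"
  proof (rule mult_right_mono)
    have "(y - q\<^sup>2) * 1 \<le> (y - q\<^sup>2) * (1 / y)" using y y0 by (intro mult_left_mono) auto
    then show "y - q\<^sup>2 \<le> 1 - q\<^sup>2 / y" using y0 by (simp add: field_simps)
  qed (use L in simp)
  with A2 have A3: "(y - q\<^sup>2) * L \<le> A" by linarith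
  have "L * ((y - q\<^sup>2) * L) * L \<le> L * A * B"
    using L B A1 A3 y by (intro mult_mono) auto
  moreover have "(1 - y) * 1 \<le> (1 - y) * (1 / y)"
    using y y0 by (intro mult_left_mono) auto
  ultimately have "(1 - y) * (L * ((y - q\<^sup>2) * L) * L) \<le> (1 - y) / y * (L * A * B)"
    using y y0 L by (intro mult_mono[of "1 - y" "(1 - y) / y"]) auto
  then show "theta_series (\<lambda>_. 1) q y \<le> - (qpoch_inf (q\<^sup>2) (q\<^sup>2) ^ 3 * ((1 - y) * (y - q\<^sup>2)))"
    unfolding T L_def [symmetric] by (simp add: power3_eq_cube mult_ac)
  have "L * A \<le> 1 * 1" using L A1 by (intro mult_mono) auto
  then have "L * A * B \<le> 1 * 1" using L A1 B B1 by (intro mult_mono) auto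
  moreover have "(1 - y) / y \<le> (1 - y) / q\<^sup>2" using y p mult_pos_pos[OF y0 p(1)] by (intro divide_left_mono) (auto simp del: zero_less_mult_iff)
  moreover have "0 \<le> L * A * B" using L A1 B by simp
  ultimately have "(1 - y) / y * (L * A * B) \<le> (1 - y) / q\<^sup>2 * 1"
    using y p by (intro mult_mono[of "(1 - y) / y" "(1 - y) / q\<^sup>2"]) auto
  then show "- ((1 - y) / q\<^sup>2) \<le> theta_series (\<lambda>_. 1) q y" unfolding T by simp
qed

section \<open>The Euler derivative of the theta function\<close>
lemma linear_growth_const: "linear_growth 1 (\<lambda>_. 1)"
  by (rule linear_growth_bounded) simp

lemma linear_growth_of_int: "linear_growth 1 of_int"
  by (simp add: linear_growth_def)

text \<open>Termwise differentiation. One-sided derivatives at the ends of the interval are all that is needed later, and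
  staying inside the interval keeps the uniform majorant available.\<close>
lemma has_field_derivative_jacobi_theta:
  assumes q: "0 < q" "q < 1" and y: "y \<in> {q\<^sup>2..1}"
  shows "(theta_series (\<lambda>_. 1) q has_field_derivative theta_series of_int q y / y) (at y within {q\<^sup>2..1})"
proof -
  have p: "0 < q\<^sup>2" "q\<^sup>2 < 1" using q by (auto simp: power_less_one_iff)
  have "\<exists>g. \<forall>x\<in>{q\<^sup>2..1}. (\<lambda>j. theta_term (\<lambda>_. 1) q x j) sums g x \<and>
      (g has_field_derivative (\<Sum>j. theta_term of_int q x j / x)) (at x within {q\<^sup>2..1})"
  proof (rule has_field_derivative_series[where ?x0.0 = 1])
    fix j x assume "x \<in> {q\<^sup>2..1}"
    then have x: "0 < x" using p(1) by (metis atLeastAtMost_iff less_le_trans)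
    have A: "((\<lambda>x. x ^ j) has_field_derivative real j * x ^ j / x) (at x within {q\<^sup>2..1})"
    proof (rule DERIV_cong[OF DERIV_pow])
      show "real j * x ^ (j - Suc 0) = real j * x ^ j / x" using x by (cases j) simp_all
    qed
    have B: "((\<lambda>x. (1 / x) ^ (j + 1)) has_field_derivative - (real j + 1) * (1 / x) ^ (j + 1) / x) (at x within {q\<^sup>2..1})"
    proof -
      have "((\<lambda>x. 1 / x) has_field_derivative - 1 / (x * x)) (at x within {q\<^sup>2..1})"
        using x by (auto intro!: derivative_eq_intros)
      from DERIV_power[OF this, of "j + 1"] show ?thesis
        by (rule DERIV_cong) (simp add: algebra_simps diff_divide_distrib add_divide_distrib)
    qed
    show "((\<lambda>x. theta_term (\<lambda>_. 1) q x j) has_field_derivative theta_term of_int q x j / x) (at x within {q\<^sup>2..1})"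
      unfolding theta_term_def
      by (rule DERIV_cong, rule DERIV_cmult, rule DERIV_diff)
        (use A B in \<open>auto simp: algebra_simps diff_divide_distrib add_divide_distrib\<close>)
  next
    show "uniform_limit {q\<^sup>2..1} (\<lambda>n x. \<Sum>j<n. theta_term of_int q x j / x)
        (\<lambda>x. \<Sum>j. theta_term of_int q x j / x) sequentially"
    proof (rule Weierstrass_m_test)
      fix j x assume x: "x \<in> {q\<^sup>2..1}"
      then have x0: "0 < x" using p(1) by (metis atLeastAtMost_iff less_le_trans)
      have "\<bar>theta_term of_int q x j\<bar> / x \<le> 2 * 1 * theta_majorant q j / q\<^sup>2"
        using theta_term_bound[OF q _ _ linear_growth_of_int, of x j] x x0 p
        by (intro frac_le) auto
      then show "norm (theta_term of_int q x j / x) \<le> 2 * theta_majorant q j / q\<^sup>2"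
        using x0 by simp
    next
      show "summable (\<lambda>j. 2 * theta_majorant q j / q\<^sup>2)"
        by (intro summable_divide summable_mult summable_theta_majorant q)
    qed
  next
    show "summable (\<lambda>j. theta_term (\<lambda>_. 1) q 1 j)"
      using summable_theta_term[OF q _ _ linear_growth_const, of 1] p by simp
  qed (use p in auto)
  then obtain g where g: "\<And>x. x \<in> {q\<^sup>2..1} \<Longrightarrow> (\<lambda>j. theta_term (\<lambda>_. 1) q x j) sums g x"
    "\<And>x. x \<in> {q\<^sup>2..1} \<Longrightarrow> (g has_field_derivative (\<Sum>j. theta_term of_int q x j / x)) (at x within {q\<^sup>2..1})"
    by blast
  have "theta_series (\<lambda>_. 1) q x = g x" if "x \<in> {q\<^sup>2..1}" for x
    using g(1)[OF that] by (simp add: theta_series_def sums_iff)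
  then have "(theta_series (\<lambda>_. 1) q has_field_derivative (\<Sum>j. theta_term of_int q y j / y)) (at y within {q\<^sup>2..1})"
    using g(2)[OF y] has_derivative_transform[OF y] unfolding has_field_derivative_def by blast
  moreover have "(\<Sum>j. theta_term of_int q y j / y) = theta_series of_int q y / y"
    unfolding theta_series_def using summable_theta_term[OF q _ _ linear_growth_of_int, of y] y
    by (intro suminf_divide) auto
  ultimately show ?thesis by simp
qed

lemma continuous_on_theta_series:
  assumes q: "0 < q" "q < 1" and u: "linear_growth K u"
  shows "continuous_on {q\<^sup>2..1} (theta_series u q)"
proof -
  have p: "0 < q\<^sup>2" using q by simp
  have "continuous_on {q\<^sup>2..1} (\<lambda>x. \<Sum>j. theta_term u q x j)"
  proof (rule uniform_limit_theorem)
    show "uniform_limit {q\<^sup>2..1} (\<lambda>n x. \<Sum>j<n. theta_term u q x j) (\<lambda>x. \<Sum>j. theta_term u q x j) sequentially"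
    proof (rule Weierstrass_m_test)
      show "norm (theta_term u q x j) \<le> 2 * K * theta_majorant q j" if "x \<in> {q\<^sup>2..1}" for j x
        using theta_term_bound[OF q _ _ u, of x j] that by simp
      show "summable (\<lambda>j. 2 * K * theta_majorant q j)"
        by (intro summable_mult summable_theta_majorant q)
    qed
    have "continuous_on {q\<^sup>2..1} (\<lambda>x. \<Sum>j<n. theta_term u q x j)" for n
      unfolding theta_term_def using p by (intro continuous_intros) auto
    then show "\<forall>\<^sub>F n in sequentially. continuous_on {q\<^sup>2..1} (\<lambda>x. \<Sum>j<n. theta_term u q x j)"
      by simp
  qed simp
  then show ?thesis by (simp add: theta_series_def[abs_def])
qed

lemma jacobi_theta_endpoints:
  assumes q: "0 < q" "q < 1"
  shows "theta_series (\<lambda>_. 1) q 1 = 0" "theta_series (\<lambda>_. 1) q (q\<^sup>2) = 0"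
proof -
  have p: "0 < q\<^sup>2" "q\<^sup>2 < 1" using q by (auto simp: power_less_one_iff)
  show "theta_series (\<lambda>_. 1) q 1 = 0" using jacobi_triple_product[OF q, of 1] p by simp
  show "theta_series (\<lambda>_. 1) q (q\<^sup>2) = 0"
    using jacobi_triple_product[OF q, of "q\<^sup>2"] p qpoch_inf_shift[OF p, of 1] by simp
qed

text \<open>The theta function vanishes at both ends of the interval and lies below \<open>- c (1 - y) (y - q\<^sup>2)\<close>, so the
  difference quotients at \<open>1\<close> and at \<open>q\<^sup>2\<close> are bounded by \<open>c (y - q\<^sup>2)\<close> from below and by
  \<open>- c (1 - y)\<close> from above, respectively.\<close>
lemma theta_derivative_signs_endpoints:
  assumes q: "0 < q" "q < 1"
  shows "0 < theta_series of_int q 1" "theta_series of_int q (q\<^sup>2) < 0"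
proof -
  have p: "0 < q\<^sup>2" "q\<^sup>2 < 1" using q by (auto simp: power_less_one_iff)
  define T where "T = theta_series (\<lambda>_. 1) q"
  define c where "c = qpoch_inf (q\<^sup>2) (q\<^sup>2) ^ 3"
  have c: "0 < c" unfolding c_def using p q by (intro zero_less_power qpoch_inf_pos) auto
  have T: "T y \<le> - (c * ((1 - y) * (y - q\<^sup>2)))" if "y \<in> {q\<^sup>2..1}" for y
    using jacobi_theta_bounds(1)[OF q, of y] that by (simp add: T_def c_def)
  have T0: "T 1 = 0" "T (q\<^sup>2) = 0" using jacobi_theta_endpoints[OF q] by (simp_all add: T_def)
  have "c * (1 - q\<^sup>2) \<le> theta_series of_int q 1 / 1"
  proof (rule tendsto_le)
    show "at 1 within {q\<^sup>2..1} \<noteq> bot" using p by (simp add: at_within_Icc_at_left)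
    show "((\<lambda>y. (T y - T 1) / (y - 1)) \<longlongrightarrow> theta_series of_int q 1 / 1) (at 1 within {q\<^sup>2..1})"
      using has_field_derivative_jacobi_theta[OF q, of 1] p unfolding has_field_derivative_iff T_def by simp
    show "((\<lambda>y. c * (y - q\<^sup>2)) \<longlongrightarrow> c * (1 - q\<^sup>2)) (at 1 within {q\<^sup>2..1})"
      by (intro tendsto_intros)
    have "c * (y - q\<^sup>2) \<le> (T y - T 1) / (y - 1)" if "y \<in> {q\<^sup>2..1}" "y \<noteq> 1" for y
    proof -
      have "c * (y - q\<^sup>2) * (1 - y) \<le> - T y" using T[OF that(1)] by (simp add: mult_ac)
      moreover have "0 < 1 - y" using that by simp
      ultimately have "c * (y - q\<^sup>2) \<le> - T y / (1 - y)" by (simp only: pos_le_divide_eq)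
      also have "\<dots> = (T y - T 1) / (y - 1)" using that by (simp add: T0 divide_simps) (simp add: algebra_simps)
      finally show ?thesis .
    qed
    then show "\<forall>\<^sub>F y in at 1 within {q\<^sup>2..1}. c * (y - q\<^sup>2) \<le> (T y - T 1) / (y - 1)"
      by (auto simp: eventually_at_filter)
  qed
  moreover have "0 < c * (1 - q\<^sup>2)" using c p by simp
  ultimately show "0 < theta_series of_int q 1" by simp
  have "theta_series of_int q (q\<^sup>2) / q\<^sup>2 \<le> - (c * (1 - q\<^sup>2))"
  proof (rule tendsto_le)
    show "at (q\<^sup>2) within {q\<^sup>2..1} \<noteq> bot" using p by (simp add: at_within_Icc_at_right)
    show "((\<lambda>y. (T y - T (q\<^sup>2)) / (y - q\<^sup>2)) \<longlongrightarrow> theta_series of_int q (q\<^sup>2) / q\<^sup>2) (at (q\<^sup>2) within {q\<^sup>2..1})"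
      using has_field_derivative_jacobi_theta[OF q, of "q\<^sup>2"] p unfolding has_field_derivative_iff T_def by simp
    show "((\<lambda>y. - (c * (1 - y))) \<longlongrightarrow> - (c * (1 - q\<^sup>2))) (at (q\<^sup>2) within {q\<^sup>2..1})"
      by (intro tendsto_intros)
    have "(T y - T (q\<^sup>2)) / (y - q\<^sup>2) \<le> - (c * (1 - y))" if "y \<in> {q\<^sup>2..1}" "y \<noteq> q\<^sup>2" for y
      using T[OF that(1)] that by (simp add: T0 pos_divide_le_eq mult_ac)
    then show "\<forall>\<^sub>F y in at (q\<^sup>2) within {q\<^sup>2..1}. (T y - T (q\<^sup>2)) / (y - q\<^sup>2) \<le> - (c * (1 - y))"
      by (auto simp: eventually_at_filter)
  qed
  with \<open>0 < c * (1 - q\<^sup>2)\<close> have "theta_series of_int q (q\<^sup>2) / q\<^sup>2 < 0" by linarith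
  then show "theta_series of_int q (q\<^sup>2) < 0" using p by (simp add: divide_less_0_iff)
qed

section \<open>Sign of the theta series with affine coefficients\<close>
lemma theta_series_affine:
  assumes q: "0 < q" "q < 1" and y: "q\<^sup>2 \<le> y" "y \<le> 1"
  shows "theta_series (\<lambda>n. 2 * (real m + of_int n) + \<nu>) q y
       = (2 * real m + \<nu>) * theta_series (\<lambda>_. 1) q y + 2 * theta_series of_int q y"
proof -
  have "(\<lambda>n. 2 * (real m + of_int n) + \<nu>) = (\<lambda>n::int. (2 * real m + \<nu>) * 1 + 2 * of_int n)"
    by (simp add: fun_eq_iff)
  then show ?thesis
    using theta_series_lincomb[OF q y linear_growth_const linear_growth_of_int, of "2 * real m + \<nu>" 2] by simp
qed

text \<open>The theta function is \<open>O(1 - y)\<close>, hence its contribution, of size \<open>m (1 - y m)\<close>, tends to \<open>0\<close> and the Euler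
  derivative at \<open>1\<close> decides.\<close>
lemma theta_series_affine_LIMSEQ:
  assumes q: "0 < q" "q < 1" and y: "\<And>m. q\<^sup>2 \<le> y m" "\<And>m. y m \<le> 1"
    and lim: "(\<lambda>m. real m * (1 - y m)) \<longlonglongrightarrow> 0"
  shows "(\<lambda>m. theta_series (\<lambda>n. 2 * (real m + of_int n) + \<nu>) q (y m)) \<longlonglongrightarrow> 2 * theta_series of_int q 1"
proof -
  have p: "0 < q\<^sup>2" "q\<^sup>2 < 1" using q by (auto simp: power_less_one_iff)
  have y0: "(\<lambda>m. 1 - y m) \<longlonglongrightarrow> 0"
  proof (rule Lim_null_comparison[OF _ lim])
    show "\<forall>\<^sub>F m in sequentially. norm (1 - y m) \<le> real m * (1 - y m)"
      using eventually_ge_at_top[of 1]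
    proof eventually_elim
      case (elim m)
      then show ?case using y[of m] mult_right_mono[of 1 "real m" "1 - y m"] by simp
    qed
  qed
  have y1: "y \<longlonglongrightarrow> 1" using tendsto_diff[OF tendsto_const[of 1] y0] by simp
  have "(\<lambda>m. theta_series of_int q (y m)) \<longlonglongrightarrow> theta_series of_int q 1"
    by (rule continuous_on_tendsto_compose[OF continuous_on_theta_series[OF q linear_growth_of_int] y1])
      (use y p in auto)
  moreover have "(\<lambda>m. (2 * real m + \<nu>) * theta_series (\<lambda>_. 1) q (y m)) \<longlonglongrightarrow> 0"
  proof (rule Lim_null_comparison)
    show "\<forall>\<^sub>F m in sequentially. norm ((2 * real m + \<nu>) * theta_series (\<lambda>_. 1) q (y m))
       \<le> (2 * (real m * (1 - y m)) + \<bar>\<nu>\<bar> * (1 - y m)) / q\<^sup>2"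
    proof (rule always_eventually, rule allI)
      fix m
      have "0 \<le> qpoch_inf (q\<^sup>2) (q\<^sup>2) ^ 3 * ((1 - y m) * (y m - q\<^sup>2))"
        using p q y by (intro mult_nonneg_nonneg zero_le_power qpoch_inf_nonneg) auto
      then have "\<bar>theta_series (\<lambda>_. 1) q (y m)\<bar> \<le> (1 - y m) / q\<^sup>2"
        using jacobi_theta_bounds[OF q y] by (smt (verit))
      then have "\<bar>2 * real m + \<nu>\<bar> * \<bar>theta_series (\<lambda>_. 1) q (y m)\<bar> \<le> (2 * real m + \<bar>\<nu>\<bar>) * ((1 - y m) / q\<^sup>2)"
        by (intro mult_mono) auto
      then show "norm ((2 * real m + \<nu>) * theta_series (\<lambda>_. 1) q (y m)) \<le> (2 * (real m * (1 - y m)) + \<bar>\<nu>\<bar> * (1 - y m)) / q\<^sup>2"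
        unfolding real_norm_def abs_mult by (simp add: algebra_simps)
    qed
    have "(\<lambda>m. (2 * (real m * (1 - y m)) + \<bar>\<nu>\<bar> * (1 - y m)) / q\<^sup>2) \<longlonglongrightarrow> (2 * 0 + \<bar>\<nu>\<bar> * 0) / q\<^sup>2"
      using p by (intro tendsto_intros lim y0) auto
    then show "(\<lambda>m. (2 * (real m * (1 - y m)) + \<bar>\<nu>\<bar> * (1 - y m)) / q\<^sup>2) \<longlonglongrightarrow> 0" by simp
  qed
  ultimately have "(\<lambda>m. (2 * real m + \<nu>) * theta_series (\<lambda>_. 1) q (y m) + 2 * theta_series of_int q (y m))
      \<longlonglongrightarrow> 0 + 2 * theta_series of_int q 1"
    by (intro tendsto_add tendsto_mult tendsto_const)
  then show ?thesis unfolding theta_series_affine[OF q y] by simp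
qed

text \<open>Near \<open>q\<^sup>2\<close> the theta function may be arbitrarily small, but it is nonpositive and the Euler derivative is negative
  by continuity. On the rest of the interval the theta function is at most a negative multiple of \<open>1 - y\<close>, and the
  assumption makes its product with \<open>m\<close> beat any bound on the Euler derivative.\<close>
lemma theta_series_affine_eventually_negative:
  assumes q: "0 < q" "q < 1" and y: "\<And>m. q\<^sup>2 \<le> y m" "\<And>m. y m \<le> 1"
    and lim: "filterlim (\<lambda>m. real m * (1 - y m)) at_top sequentially"
  shows "\<exists>\<epsilon>>0. \<forall>\<^sub>F m in sequentially. theta_series (\<lambda>n. 2 * (real m + of_int n) + \<nu>) q (y m) \<le> - \<epsilon>"
proof -
  have p: "0 < q\<^sup>2" "q\<^sup>2 < 1" using q by (auto simp: power_less_one_iff)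
  define T D where "T = theta_series (\<lambda>_. 1) q" and "D = theta_series of_int q"
  define c where "c = qpoch_inf (q\<^sup>2) (q\<^sup>2) ^ 3"
  have c: "0 < c" unfolding c_def using p q by (intro zero_less_power qpoch_inf_pos) auto
  have T: "T x \<le> - (c * ((1 - x) * (x - q\<^sup>2)))" if "q\<^sup>2 \<le> x" "x \<le> 1" for x
    using jacobi_theta_bounds(1)[OF q that] by (simp add: T_def c_def)
  have cont: "continuous_on {q\<^sup>2..1} D"
    unfolding D_def by (rule continuous_on_theta_series[OF q linear_growth_of_int])
  \<comment> \<open>The value at \<open>q\<^sup>2\<close> is \<open>- 2 e\<close>, so the Euler derivative stays below \<open>- e\<close> close to \<open>q\<^sup>2\<close>.\<close>
  define e where "e = - D (q\<^sup>2) / 2"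
  have e: "0 < e" using theta_derivative_signs_endpoints(2)[OF q] by (simp add: e_def D_def)
  obtain d where d: "0 < d" "\<And>x. x \<in> {q\<^sup>2..1} \<Longrightarrow> dist x (q\<^sup>2) < d \<Longrightarrow> dist (D x) (D (q\<^sup>2)) < e"
    using cont p e unfolding continuous_on_iff by (metis atLeastAtMost_iff less_imp_le order_refl)
  have near: "D x \<le> - e" if "q\<^sup>2 \<le> x" "x \<le> 1" "x < q\<^sup>2 + d" for x
  proof -
    have "dist (D x) (D (q\<^sup>2)) < e" using that by (intro d) (auto simp: dist_real_def)
    moreover have "D (q\<^sup>2) = - 2 * e" by (simp add: e_def)
    ultimately show ?thesis by (simp add: dist_real_def abs_less_iff)
  qed
  have "bounded (D ` {q\<^sup>2..1})"
    by (intro compact_imp_bounded compact_continuous_image cont) simp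
  then obtain B where B: "\<And>x. x \<in> {q\<^sup>2..1} \<Longrightarrow> D x \<le> B"
    unfolding bounded_real by (metis abs_le_D1 imageI)
  \<comment> \<open>The threshold makes \<open>c d m (1 - y m)\<close> at least \<open>2 B + 2 e\<close>, which outweighs twice the Euler derivative.\<close>
  have "\<forall>\<^sub>F m in sequentially. (2 * B + 2 * e) / (c * d) + 1 \<le> real m * (1 - y m)"
    using lim by (simp add: filterlim_at_top)
  moreover have "\<forall>\<^sub>F m in sequentially. - \<nu> \<le> real m"
    using filterlim_real_sequentially by (simp add: filterlim_at_top)
  ultimately have "\<forall>\<^sub>F m in sequentially. (2 * real m + \<nu>) * T (y m) + 2 * D (y m) \<le> - (2 * e)"
  proof eventually_elim
    case (elim m)
    have T0: "T (y m) \<le> 0"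
      using T[OF y] c y[of m] mult_nonneg_nonneg[of "1 - y m" "y m - q\<^sup>2"] mult_nonneg_nonneg[of c "(1 - y m) * (y m - q\<^sup>2)"]
      by (smt (verit))
    show ?case
    proof (cases "y m < q\<^sup>2 + d")
      case True
      then have "D (y m) \<le> - e" using near y by blast
      moreover have "(2 * real m + \<nu>) * T (y m) \<le> 0"
        using T0 elim by (intro mult_nonneg_nonpos) auto
      ultimately show ?thesis by linarith
    next
      case False
      have "c * ((1 - y m) * d) \<le> c * ((1 - y m) * (y m - q\<^sup>2))"
        using False c y[of m] by (intro mult_left_mono) auto
      then have T1: "T (y m) \<le> - (c * ((1 - y m) * d))" using T[OF y, of m] by linarith
      have "(2 * real m + \<nu>) * T (y m) \<le> real m * T (y m)"
        using elim T0 by (intro mult_right_mono_neg) auto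
      also have "\<dots> \<le> real m * (- (c * ((1 - y m) * d)))"
        using T1 by (intro mult_left_mono) auto
      also have "\<dots> = - (c * d) * (real m * (1 - y m))" by simp
      also have "\<dots> \<le> - (c * d) * ((2 * B + 2 * e) / (c * d))"
        using elim c d by (intro mult_left_mono_neg) auto
      also have "\<dots> = - (2 * B + 2 * e)" using c d by simp
      finally show ?thesis using B[of "y m"] y[of m] by simp
    qed
  qed
  then have "\<forall>\<^sub>F m in sequentially. theta_series (\<lambda>n. 2 * (real m + of_int n) + \<nu>) q (y m) \<le> - (2 * e)"
    unfolding theta_series_affine[OF q y] T_def D_def .
  then show ?thesis using e by (intro exI[of _ "2 * e"]) simp
qed

text \<open>The error coefficients are \<open>(2 k + \<nu>) (w k - W)\<close> with \<open>k = m + n\<close> when this index is nonnegative. These are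
  bounded, and for fixed \<open>n\<close> they tend to \<open>0\<close>. When \<open>m + n\<close> is negative, \<open>\<bar>m + n\<bar>\<close> is at most \<open>\<bar>n\<bar>\<close>, so the missing weights
  cost no more than linear growth in \<open>n\<close>, uniformly in \<open>m\<close>.\<close>
lemma theta_series_perturbation:
  fixes w :: "nat \<Rightarrow> real"
  assumes q: "0 < q" "q < 1" and y: "\<And>m. q\<^sup>2 \<le> y m" "\<And>m. y m \<le> 1"
    and w: "(\<lambda>k. (2 * real k + \<nu>) * (w k - W)) \<longlonglongrightarrow> 0"
  shows "(\<lambda>m. theta_series (shifted_coeff m (\<lambda>k. (2 * real k + \<nu>) * w k)) q (y m)
             - W * theta_series (\<lambda>n. 2 * (real m + of_int n) + \<nu>) q (y m)) \<longlonglongrightarrow> 0"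
proof -
  define h where "h k = (2 * real k + \<nu>) * (w k - W)" for k
  have h0: "h \<longlonglongrightarrow> 0" using w by (simp add: h_def[abs_def])
  then have "Bseq h" by (intro convergent_imp_Bseq convergentI)
  then obtain K where K: "\<And>k. \<bar>h k\<bar> \<le> K" unfolding Bseq_def by (metis real_norm_def)
  define u where "u m n = (if 0 \<le> int m + n then h (nat (int m + n)) else - W * (2 * (real m + of_int n) + \<nu>))" for m n
  define L where "L = K + \<bar>W\<bar> * (2 + \<bar>\<nu>\<bar>)"
  have K0: "0 \<le> K" using K[of 0] by linarith
  have lgu: "linear_growth L (u m)" for m
    unfolding linear_growth_def
  proof
    fix n :: int
    have L: "K \<le> L" "0 \<le> L" using K0 by (simp_all add: L_def)
    show "\<bar>u m n\<bar> \<le> L * (1 + \<bar>of_int n\<bar>)"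
    proof (cases "0 \<le> int m + n")
      case True
      have "\<bar>u m n\<bar> \<le> K" using True K by (simp add: u_def)
      also have "\<dots> \<le> L * 1" using L by simp
      also have "\<dots> \<le> L * (1 + \<bar>of_int n\<bar>)" using L by (intro mult_left_mono) auto
      finally show ?thesis .
    next
      case False
      then have "\<bar>real m + of_int n\<bar> \<le> \<bar>of_int n :: real\<bar>" by linarith
      then have "\<bar>2 * (real m + of_int n) + \<nu>\<bar> \<le> 2 * \<bar>of_int n\<bar> + \<bar>\<nu>\<bar> * 1"
        using abs_triangle_ineq[of "2 * (real m + of_int n)" \<nu>] by (simp add: abs_mult)
      also have "\<dots> \<le> (2 + \<bar>\<nu>\<bar>) * (1 + \<bar>of_int n\<bar>)"
        by (simp add: algebra_simps)
      finally have "\<bar>W\<bar> * \<bar>2 * (real m + of_int n) + \<nu>\<bar> \<le> \<bar>W\<bar> * ((2 + \<bar>\<nu>\<bar>) * (1 + \<bar>of_int n\<bar>))"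
        by (intro mult_left_mono) auto
      also have "\<dots> \<le> L * (1 + \<bar>of_int n\<bar>)"
        unfolding mult.assoc [symmetric] using K0 by (intro mult_right_mono) (auto simp: L_def)
      finally show ?thesis using False by (simp add: u_def abs_mult)
    qed
  qed
  have "linear_growth (2 * real m + \<bar>\<nu>\<bar> + 2) (\<lambda>n. 2 * (real m + of_int n) + \<nu>)" for m
    unfolding linear_growth_def
  proof
    fix n :: int
    have "\<bar>2 * (real m + of_int n) + \<nu>\<bar> \<le> 2 * real m + \<bar>\<nu>\<bar> + 2 * \<bar>of_int n\<bar>"
      using of_nat_0_le_iff[of m, where 'a = real] by (simp add: abs_le_iff) linarith
    also have "\<dots> \<le> (2 * real m + \<bar>\<nu>\<bar> + 2) * (1 + \<bar>of_int n\<bar>)" by (simp add: algebra_simps)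
    finally show "\<bar>2 * (real m + of_int n) + \<nu>\<bar> \<le> (2 * real m + \<bar>\<nu>\<bar> + 2) * (1 + \<bar>of_int n\<bar>)" .
  qed
  note lga = this
  have "shifted_coeff m (\<lambda>k. (2 * real k + \<nu>) * w k) = (\<lambda>n. 1 * u m n + W * (2 * (real m + of_int n) + \<nu>))" for m
  proof
    fix n :: int
    show "shifted_coeff m (\<lambda>k. (2 * real k + \<nu>) * w k) n = 1 * u m n + W * (2 * (real m + of_int n) + \<nu>)"
    proof (cases "0 \<le> int m + n")
      case True
      then have "real (nat (int m + n)) = real m + of_int n" by simp
      then show ?thesis using True by (simp add: shifted_coeff_def u_def h_def algebra_simps)
    qed (simp add: shifted_coeff_def u_def)
  qed
  then have "theta_series (shifted_coeff m (\<lambda>k. (2 * real k + \<nu>) * w k)) q (y m)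
      = 1 * theta_series (u m) q (y m) + W * theta_series (\<lambda>n. 2 * (real m + of_int n) + \<nu>) q (y m)" for m
    by (simp only: theta_series_lincomb[OF q y lgu lga])
  moreover have "(\<lambda>m. theta_series (u m) q (y m)) \<longlonglongrightarrow> 0"
  proof (rule theta_series_tendsto_0[OF q y lgu])
    fix n
    have "(\<lambda>m. h (nat (int m + n))) \<longlonglongrightarrow> 0"
      by (rule filterlim_compose[OF h0 filterlim_nat_shift[OF filterlim_ident]])
    moreover have "\<forall>\<^sub>F m in sequentially. h (nat (int m + n)) = u m n"
      using eventually_ge_at_top[of "nat \<bar>n\<bar>"] by eventually_elim (auto simp: u_def)
    ultimately show "(\<lambda>m. u m n) \<longlonglongrightarrow> 0" by (rule Lim_transform_eventually)
  qed
  ultimately show ?thesis by simp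
qed

section \<open>The derivative of the Hahn--Exton function\<close>
definition hahn_exton_weight :: "real \<Rightarrow> real \<Rightarrow> nat \<Rightarrow> real" where
  "hahn_exton_weight a p k = 1 / (qpoch a p k * qpoch p p k)"

lemma hahn_exton_weight_rate:
  assumes a: "0 \<le> a" "a < 1" and p: "0 < p" "p < 1"
  shows "(\<lambda>k. (2 * real k + \<nu>) * (hahn_exton_weight a p k - 1 / (qpoch_inf a p * qpoch_inf p p))) \<longlonglongrightarrow> 0"
proof -
  define u v U V where "u = qpoch a p" and "v = qpoch p p" and "U = qpoch_inf a p" and "V = qpoch_inf p p"
  have pos: "0 < u k" "0 < v k" "0 < U" "0 < V" for k
    using a p by (auto simp: u_def v_def U_def V_def intro: qpoch_pos qpoch_inf_pos)
  have lim: "u \<longlonglongrightarrow> U" "v \<longlonglongrightarrow> V"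
    unfolding u_def v_def U_def V_def by (intro qpoch_LIMSEQ p)+
  have rate: "(\<lambda>k. real k * (u k - U)) \<longlonglongrightarrow> 0" "(\<lambda>k. real k * (v k - V)) \<longlonglongrightarrow> 0"
    unfolding u_def v_def U_def V_def using a p by (auto intro: qpoch_rate)
  have "(\<lambda>k. - ((2 * (real k * (u k - U)) + \<nu> * (u k - U)) * v k + U * (2 * (real k * (v k - V)) + \<nu> * (v k - V)))
           / (U * V * (u k * v k))) \<longlonglongrightarrow> - ((2 * 0 + \<nu> * (U - U)) * V + U * (2 * 0 + \<nu> * (V - V))) / (U * V * (U * V))"
    using pos(3,4) by (intro tendsto_intros lim rate) auto
  moreover have "- ((2 * (real k * (u k - U)) + \<nu> * (u k - U)) * v k + U * (2 * (real k * (v k - V)) + \<nu> * (v k - V)))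
           / (U * V * (u k * v k)) = (2 * real k + \<nu>) * (hahn_exton_weight a p k - 1 / (U * V))" for k
  proof -
    have "1 / (u k * v k) - 1 / (U * V) = - ((u k - U) * v k + U * (v k - V)) / (U * V * (u k * v k))"
      using pos(1,2)[of k] pos(3,4) by (simp add: divide_simps) (simp add: algebra_simps)
    moreover have "hahn_exton_weight a p k = 1 / (u k * v k)"
      by (simp add: hahn_exton_weight_def u_def v_def)
    ultimately show ?thesis by (simp add: algebra_simps)
  qed
  ultimately show ?thesis by (simp add: U_def V_def)
qed

lemma summable_gaussian_weighted:
  fixes q x :: real
  assumes q: "0 < q" "q < 1" and g: "\<And>k. \<bar>g k\<bar> \<le> K * (real k + 2)"
  shows "summable (\<lambda>k. (-1) ^ k * q ^ (k * (k + 1)) * g k * x ^ k)"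
proof (rule summable_comparison_test')
  show "summable (\<lambda>k. K * ((real k + 2) * q ^ (k * (k + 1)) * \<bar>x\<bar> ^ k))"
    by (intro summable_mult summable_gaussian q)
  show "norm ((-1) ^ k * q ^ (k * (k + 1)) * g k * x ^ k) \<le> K * ((real k + 2) * q ^ (k * (k + 1)) * \<bar>x\<bar> ^ k)"
    if "0 \<le> k" for k
  proof -
    have "\<bar>g k\<bar> * (q ^ (k * (k + 1)) * \<bar>x\<bar> ^ k) \<le> K * (real k + 2) * (q ^ (k * (k + 1)) * \<bar>x\<bar> ^ k)"
      using q by (intro mult_right_mono g) auto
    then show ?thesis using q by (simp add: abs_mult power_abs mult_ac)
  qed
qed

lemma hahn_exton_weight_bound:
  assumes "0 \<le> a" "a < 1" "0 < p" "p < 1"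
  shows "\<bar>hahn_exton_weight a p k\<bar> \<le> 1 / (qpoch_inf a p * qpoch_inf p p)"
proof -
  have "0 < qpoch a p k" "0 < qpoch p p k" "0 < qpoch_inf a p" "0 < qpoch_inf p p"
    using assms by (auto intro: qpoch_pos qpoch_inf_pos)
  moreover have "qpoch_inf a p \<le> qpoch a p k" "qpoch_inf p p \<le> qpoch p p k"
    using assms by (auto intro: qpoch_inf_le)
  ultimately show ?thesis unfolding hahn_exton_weight_def
    by (auto simp: abs_mult intro!: frac_le mult_mono)
qed

text \<open>With \<open>J(z) = C z\<^sup>\<nu> F(z\<^sup>2)\<close> one has \<open>J'(z) = C z\<^bsup>\<nu>-1\<^esup> (\<nu> F(x) + 2 x F'(x))\<close> at \<open>x = z\<^sup>2\<close>, and the operator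
  \<open>\<nu> + 2 x d/dx\<close> multiplies the coefficient of \<open>x\<^sup>k\<close> by \<open>2 k + \<nu>\<close>.\<close>
lemma deriv_hahn_exton_J:
  fixes q \<nu> z :: real
  assumes q: "0 < q" "q < 1" and nu: "\<nu> > -1" and z: "0 < z"
  defines "a \<equiv> q powr (2 * (\<nu> + 1))"
  shows "deriv (hahn_exton_J \<nu> q) z = z powr (\<nu> - 1) * (qpoch_inf a (q\<^sup>2) / qpoch_inf (q\<^sup>2) (q\<^sup>2)) *
     (\<Sum>k. (-1) ^ k * q ^ (k * (k + 1)) * ((2 * real k + \<nu>) * hahn_exton_weight a (q\<^sup>2) k) * (z\<^sup>2) ^ k)"
proof -
  have p: "0 < q\<^sup>2" "q\<^sup>2 < 1" using q by (auto simp: power_less_one_iff)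
  have a: "0 \<le> a" "a < 1" using q nu by (auto simp: a_def powr01_less_one)
  define w where "w = hahn_exton_weight a (q\<^sup>2)"
  define C where "C = qpoch_inf a (q\<^sup>2) / qpoch_inf (q\<^sup>2) (q\<^sup>2)"
  define c where "c k = (-1) ^ k * q ^ (k * (k + 1)) * w k" for k
  define F where "F x = (\<Sum>k. c k * x ^ k)" for x
  define F' where "F' x = (\<Sum>k. diffs c k * x ^ k)" for x
  define K where "K = 1 / (qpoch_inf a (q\<^sup>2) * qpoch_inf (q\<^sup>2) (q\<^sup>2))"
  have w: "\<bar>w k\<bar> \<le> K * (real k + 2)" for k
  proof -
    have "\<bar>w k\<bar> \<le> K" unfolding w_def K_def by (rule hahn_exton_weight_bound[OF a p])
    moreover from this have "K * 1 \<le> K * (real k + 2)" by (intro mult_left_mono) auto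
    ultimately show ?thesis by linarith
  qed
  have sm: "summable (\<lambda>k. c k * x ^ k)" for x
    unfolding c_def by (rule summable_gaussian_weighted[OF q w])
  have DF: "(F has_field_derivative F' x) (at x)" for x
    unfolding F_def[abs_def] F'_def by (rule termdiffs_strong_converges_everywhere[OF sm])
  have J: "hahn_exton_J \<nu> q = (\<lambda>z. z powr \<nu> * C * F (z\<^sup>2))"
  proof
    fix z
    have "(\<lambda>k. (-1) ^ k * (q ^ (k * (k + 1)) / (qpoch a (q\<^sup>2) k * qpoch (q\<^sup>2) (q\<^sup>2) k)) * z ^ (2 * k)) = (\<lambda>k. c k * (z\<^sup>2) ^ k)"
      by (simp add: fun_eq_iff c_def w_def hahn_exton_weight_def power_mult)
    then show "hahn_exton_J \<nu> q z = z powr \<nu> * C * F (z\<^sup>2)"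
      by (simp add: hahn_exton_J_def F_def C_def a_def)
  qed
  have "((\<lambda>z. z powr \<nu> * C * F (z\<^sup>2)) has_field_derivative
      (\<nu> * z powr (\<nu> - 1) * C) * F (z\<^sup>2) + F' (z\<^sup>2) * (2 * z) * (z powr \<nu> * C)) (at z)"
  proof (rule DERIV_mult)
    show "((\<lambda>z. z powr \<nu> * C) has_field_derivative \<nu> * z powr (\<nu> - 1) * C) (at z)"
      by (intro DERIV_cmult_right has_real_derivative_powr z)
    have "((\<lambda>z. z\<^sup>2) has_field_derivative 2 * z) (at z)"
      by (auto intro!: derivative_eq_intros)
    then show "((\<lambda>z. F (z\<^sup>2)) has_field_derivative F' (z\<^sup>2) * (2 * z)) (at z)"
      by (rule DERIV_chain2[OF DF])
  qed
  then have "deriv (hahn_exton_J \<nu> q) z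
      = (\<nu> * z powr (\<nu> - 1) * C) * F (z\<^sup>2) + F' (z\<^sup>2) * (2 * z) * (z powr \<nu> * C)"
    unfolding J by (rule DERIV_imp_deriv)
  also have "z powr \<nu> = z powr (\<nu> - 1) * z"
    using z powr_add[of z "\<nu> - 1" 1] by simp
  finally have 1: "deriv (hahn_exton_J \<nu> q) z = z powr (\<nu> - 1) * C * (\<nu> * F (z\<^sup>2) + 2 * (z\<^sup>2 * F' (z\<^sup>2)))"
    by (simp add: algebra_simps power2_eq_square)
  have "(\<lambda>k. z\<^sup>2 * (real k * c k * (z\<^sup>2) ^ (k - Suc 0))) sums (z\<^sup>2 * F' (z\<^sup>2))"
    unfolding F'_def by (intro sums_mult diffs_equiv termdiff_converges_all sm)
  moreover have "z\<^sup>2 * (real k * c k * (z\<^sup>2) ^ (k - Suc 0)) = real k * c k * (z\<^sup>2) ^ k" for k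
    by (cases k) simp_all
  ultimately have "(\<lambda>k. real k * c k * (z\<^sup>2) ^ k) sums (z\<^sup>2 * F' (z\<^sup>2))" by simp
  moreover have "(\<lambda>k. c k * (z\<^sup>2) ^ k) sums F (z\<^sup>2)"
    unfolding F_def by (intro summable_sums sm)
  ultimately have "(\<lambda>k. \<nu> * (c k * (z\<^sup>2) ^ k) + 2 * (real k * c k * (z\<^sup>2) ^ k)) sums (\<nu> * F (z\<^sup>2) + 2 * (z\<^sup>2 * F' (z\<^sup>2)))"
    by (intro sums_add sums_mult)
  then have "\<nu> * F (z\<^sup>2) + 2 * (z\<^sup>2 * F' (z\<^sup>2)) = (\<Sum>k. \<nu> * (c k * (z\<^sup>2) ^ k) + 2 * (real k * c k * (z\<^sup>2) ^ k))"
    by (rule sums_unique)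
  also have "\<dots> = (\<Sum>k. (-1) ^ k * q ^ (k * (k + 1)) * ((2 * real k + \<nu>) * w k) * (z\<^sup>2) ^ k)"
    by (rule suminf_cong) (simp add: c_def algebra_simps)
  finally show ?thesis unfolding 1 C_def w_def by simp
qed

lemma sgn_deriv_hahn_exton_J:
  fixes q \<nu> \<theta> :: real
  assumes q: "0 < q" "q < 1" and nu: "\<nu> > -1"
  defines "a \<equiv> q powr (2 * (\<nu> + 1))"
  shows "sgn (deriv (hahn_exton_J \<nu> q) (q powr (- real m + \<theta>)))
    = (-1) ^ m * sgn (theta_series (shifted_coeff m (\<lambda>k. (2 * real k + \<nu>) * hahn_exton_weight a (q\<^sup>2) k)) q (q powr (2 * \<theta>)))"
proof -
  have p: "0 < q\<^sup>2" "q\<^sup>2 < 1" using q by (auto simp: power_less_one_iff)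
  have a: "0 \<le> a" "a < 1" using q nu by (auto simp: a_def powr01_less_one)
  define z where "z = q powr (- real m + \<theta>)"
  define y where "y = q powr (2 * \<theta>)"
  define g where "g k = (2 * real k + \<nu>) * hahn_exton_weight a (q\<^sup>2) k" for k
  have z: "0 < z" and y: "0 < y" using q by (simp_all add: z_def y_def)
  have zy: "z\<^sup>2 = y / (q\<^sup>2) ^ m"
  proof -
    have "z\<^sup>2 = q powr (2 * \<theta> - real (2 * m))"
      unfolding z_def power2_eq_square powr_add [symmetric] by (rule arg_cong[where f = "\<lambda>e. q powr e"]) simp
    also have "\<dots> = y / q ^ (2 * m)"
      by (simp only: powr_diff y_def powr_realpow[OF q(1)])
    finally show ?thesis by (simp add: power_mult)
  qed
  define K where "K = 1 / (qpoch_inf a (q\<^sup>2) * qpoch_inf (q\<^sup>2) (q\<^sup>2))"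
  have g: "\<bar>g k\<bar> \<le> (2 + \<bar>\<nu>\<bar>) * K * (real k + 2)" for k
  proof -
    have w: "\<bar>hahn_exton_weight a (q\<^sup>2) k\<bar> \<le> K" unfolding K_def by (rule hahn_exton_weight_bound[OF a p])
    have "\<bar>2 * real k + \<nu>\<bar> \<le> 2 * real k + \<bar>\<nu>\<bar>" by simp
    also have "\<dots> \<le> (2 + \<bar>\<nu>\<bar>) * (real k + 2)" by (simp add: algebra_simps)
    finally have "\<bar>2 * real k + \<nu>\<bar> * \<bar>hahn_exton_weight a (q\<^sup>2) k\<bar> \<le> (2 + \<bar>\<nu>\<bar>) * (real k + 2) * K"
      using w by (intro mult_mono) auto
    then show ?thesis by (simp only: g_def abs_mult mult_ac)
  qed
  have "(\<Sum>k. (-1) ^ k * q ^ (k * (k + 1)) * g k * (z\<^sup>2) ^ k)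
     = (-1) ^ m * ((q * y) ^ m / q ^ (m * m)) * theta_series (shifted_coeff m g) q y"
    unfolding zy by (rule suminf_eq_theta_series[OF q(1) y summable_gaussian_weighted[OF q g]])
  then have "deriv (hahn_exton_J \<nu> q) z = z powr (\<nu> - 1) * (qpoch_inf a (q\<^sup>2) / qpoch_inf (q\<^sup>2) (q\<^sup>2))
      * ((-1) ^ m * ((q * y) ^ m / q ^ (m * m)) * theta_series (shifted_coeff m g) q y)"
    using deriv_hahn_exton_J[OF q nu z] unfolding a_def [symmetric] g_def by simp
  moreover have "0 < z powr (\<nu> - 1)" "0 < qpoch_inf a (q\<^sup>2)" "0 < qpoch_inf (q\<^sup>2) (q\<^sup>2)"
    "0 < (q * y) ^ m / q ^ (m * m)"
    using z q y p a by (auto intro: qpoch_inf_pos)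
  moreover have "sgn ((-1::real) ^ m) = (-1) ^ m" by (cases "even m") simp_all
  ultimately have "sgn (deriv (hahn_exton_J \<nu> q) z) = (-1) ^ m * sgn (theta_series (shifted_coeff m g) q y)"
    using q y by (simp add: sgn_mult sgn_divide)
  then show ?thesis unfolding z_def y_def g_def .
qed

section \<open>Signs of the derivative\<close>

text \<open>The convex function \<open>\<theta> \<mapsto> q\<^bsup>2\<theta>\<^esup>\<close> lies below its chord over the unit interval and above its tangent at \<open>0\<close>. Hence
  \<open>m (1 - q\<^bsup>2\<theta>\<^esup>)\<close> and \<open>m \<theta>\<close> tend to \<open>0\<close>, or to infinity, together.\<close>
lemma one_minus_powr_bounds:
  fixes q \<theta> :: real
  assumes q: "0 < q" "q < 1" and t: "0 \<le> \<theta>" "\<theta> \<le> 1"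
  shows "(1 - q\<^sup>2) * \<theta> \<le> 1 - q powr (2 * \<theta>)" "1 - q powr (2 * \<theta>) \<le> - 2 * ln q * \<theta>"
proof -
  have "(q\<^sup>2) powr \<theta> * 1 powr (1 - \<theta>) \<le> \<theta> * q\<^sup>2 + (1 - \<theta>) * 1"
    using q t by (intro Youngs_inequality_0) auto
  moreover have "(q\<^sup>2) powr \<theta> = q powr (2 * \<theta>)"
    using q by (simp add: powr_powr flip: powr_numeral)
  ultimately show "(1 - q\<^sup>2) * \<theta> \<le> 1 - q powr (2 * \<theta>)" by (simp add: algebra_simps)
  have "1 + 2 * \<theta> * ln q \<le> exp (2 * \<theta> * ln q)" by (rule exp_ge_add_one_self)
  then show "1 - q powr (2 * \<theta>) \<le> - 2 * ln q * \<theta>" using q by (simp add: powr_def algebra_simps)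
qed

theorem theorem3p1:
  fixes q \<nu> :: real and \<theta> :: "nat \<Rightarrow> real"
  assumes "0 < q" and "q < 1" and "\<nu> > -1"
    and "\<And>m. m \<ge> 1 \<Longrightarrow> 0 \<le> \<theta> m \<and> \<theta> m < 1"
  shows "((\<lambda>m. real m * \<theta> m) \<longlonglongrightarrow> 0 \<longrightarrow>
           (\<forall>\<^sub>F m in sequentially.
              sgn (deriv (hahn_exton_J \<nu> q) (q powr (- real m + \<theta> m))) = (-1) ^ m)) \<and>
         (filterlim (\<lambda>m. real m * \<theta> m) at_top sequentially \<longrightarrow>
           (\<forall>\<^sub>F m in sequentially.
              sgn (deriv (hahn_exton_J \<nu> q) (q powr (- real m + \<theta> m))) = (-1) ^ (m - 1)))"
proof -
  note q = assms(1,2) and nu = assms(3) and th = assms(4)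
  have p: "0 < q\<^sup>2" "q\<^sup>2 < 1" using q by (auto simp: power_less_one_iff)
  define a where "a = q powr (2 * (\<nu> + 1))"
  have a: "0 \<le> a" "a < 1" using q nu by (auto simp: a_def powr01_less_one)
  define W where "W = 1 / (qpoch_inf a (q\<^sup>2) * qpoch_inf (q\<^sup>2) (q\<^sup>2))"
  have W: "0 < W"
    unfolding W_def using a p qpoch_inf_pos[of a "q\<^sup>2"] qpoch_inf_pos[of "q\<^sup>2" "q\<^sup>2"] by simp
  \<comment> \<open>The hypotheses say nothing about \<open>\<theta> 0\<close>; the value \<open>1\<close> at \<open>m = 0\<close> keeps the whole sequence in the interval.\<close>
  define y where "y m = (if m = 0 then 1 else q powr (2 * \<theta> m))" for m
  have y_bounds: "(1 - q\<^sup>2) * (real m * \<theta> m) \<le> real m * (1 - y m)"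
      "real m * (1 - y m) \<le> - 2 * ln q * (real m * \<theta> m)" for m
  proof -
    have "(1 - q\<^sup>2) * \<theta> m \<le> 1 - y m" "1 - y m \<le> - 2 * ln q * \<theta> m" if "m \<noteq> 0"
      using one_minus_powr_bounds[OF q, of "\<theta> m"] th[of m] that by (simp_all add: y_def)
    then show "(1 - q\<^sup>2) * (real m * \<theta> m) \<le> real m * (1 - y m)"
      "real m * (1 - y m) \<le> - 2 * ln q * (real m * \<theta> m)"
      using mult_left_mono[of "(1 - q\<^sup>2) * \<theta> m" "1 - y m" "real m"]
        mult_left_mono[of "1 - y m" "- 2 * ln q * \<theta> m" "real m"]
      by (cases "m = 0"; simp add: mult_ac)+
  qed
  have y: "q\<^sup>2 \<le> y m" "y m \<le> 1" for m
  proof -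
    have "q powr 2 \<le> q powr (2 * \<theta> m)" "q powr (2 * \<theta> m) \<le> q powr 0" if "m \<noteq> 0"
      by (rule powr_mono'; use th[of m] that q in simp)+
    then show "q\<^sup>2 \<le> y m" "y m \<le> 1" using q p by (auto simp: y_def)
  qed
  define U where "U m = theta_series (shifted_coeff m (\<lambda>k. (2 * real k + \<nu>) * hahn_exton_weight a (q\<^sup>2) k)) q (y m)" for m
  define H where "H m = theta_series (\<lambda>n. 2 * (real m + of_int n) + \<nu>) q (y m)" for m
  have UH: "(\<lambda>m. U m - W * H m) \<longlonglongrightarrow> 0"
    unfolding U_def H_def by (rule theta_series_perturbation[OF q y hahn_exton_weight_rate[OF a p, folded W_def]])
  have sgnU: "sgn (deriv (hahn_exton_J \<nu> q) (q powr (- real m + \<theta> m))) = (-1) ^ m * sgn (U m)" if "m \<ge> 1" for m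
    using sgn_deriv_hahn_exton_J[OF q nu, of m "\<theta> m"] that by (simp add: U_def y_def a_def)
  show ?thesis
  proof (intro conjI impI)
    assume lim: "(\<lambda>m. real m * \<theta> m) \<longlonglongrightarrow> 0"
    have "(\<lambda>m. real m * (1 - y m)) \<longlonglongrightarrow> 0"
    proof (rule tendsto_sandwich)
      show "(\<lambda>m. (1 - q\<^sup>2) * (real m * \<theta> m)) \<longlonglongrightarrow> 0" "(\<lambda>m. - 2 * ln q * (real m * \<theta> m)) \<longlonglongrightarrow> 0"
        using tendsto_mult_left[OF lim, of "1 - q\<^sup>2"] tendsto_mult_left[OF lim, of "- 2 * ln q"]
        by simp_all
    qed (use y_bounds in simp_all)
    then have "H \<longlonglongrightarrow> 2 * theta_series of_int q 1"
      unfolding H_def by (rule theta_series_affine_LIMSEQ[OF q y])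
    then have "(\<lambda>m. (U m - W * H m) + W * H m) \<longlonglongrightarrow> 0 + W * (2 * theta_series of_int q 1)"
      by (intro tendsto_add UH tendsto_mult tendsto_const)
    then have "U \<longlonglongrightarrow> W * (2 * theta_series of_int q 1)" by simp
    then have "\<forall>\<^sub>F m in sequentially. 0 < U m"
      by (rule order_tendstoD) (use W theta_derivative_signs_endpoints(1)[OF q] in simp)
    then show "\<forall>\<^sub>F m in sequentially. sgn (deriv (hahn_exton_J \<nu> q) (q powr (- real m + \<theta> m))) = (-1) ^ m"
      using eventually_ge_at_top[of 1]
    proof eventually_elim
      case (elim m)
      show ?case unfolding sgnU[OF elim(2)] using elim(1) by simp
    qed
  next
    assume lim: "filterlim (\<lambda>m. real m * \<theta> m) at_top sequentially"
    have "filterlim (\<lambda>m. (1 - q\<^sup>2) * (real m * \<theta> m)) at_top sequentially"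
      using p by (intro filterlim_tendsto_pos_mult_at_top[OF tendsto_const _ lim]) simp
    then have "filterlim (\<lambda>m. real m * (1 - y m)) at_top sequentially"
      by (rule filterlim_at_top_mono) (use y_bounds in simp)
    then obtain \<epsilon> where e: "0 < \<epsilon>" "\<forall>\<^sub>F m in sequentially. H m \<le> - \<epsilon>"
      unfolding H_def using theta_series_affine_eventually_negative[where y = y, OF q y] by blast
    have "\<forall>\<^sub>F m in sequentially. U m - W * H m < W * \<epsilon>"
      using UH by (rule order_tendstoD) (use W e in simp)
    then show "\<forall>\<^sub>F m in sequentially. sgn (deriv (hahn_exton_J \<nu> q) (q powr (- real m + \<theta> m))) = (-1) ^ (m - 1)"
      using e(2) eventually_ge_at_top[of 1]
    proof eventually_elim
      case (elim m)
      have "W * H m \<le> W * (- \<epsilon>)" using elim W by (intro mult_left_mono) auto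
      then have "U m < 0" using elim by simp
      moreover have "(-1) ^ m = - ((-1::real) ^ (m - 1))" using elim(3) by (cases m) simp_all
      ultimately show ?case unfolding sgnU[OF elim(3)] by simp
    qed
  qed
qed

end
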